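(* Let $\mathbb{A}^2$ be the closed annulus. Any finitely generated periodic subgroup of $\mathrm{Homeo}(\mathbb{A}^2)$ is finite.
   Context: A group $\Gamma$ is periodic if every $g\in\Gamma$ has finite order, i.e. there is a positive integer $n$ with $g^n=\mathrm{id}$. The closed annulus is $\mathbb{A}^2=\mathbb{S}^1\times[0,1]$ and $\mathrm{Homeo}(\mathbb{A}^2)$ is the group of all its homeomorphisms under composition. *)

theory Defs
  imports "HOL-Analysis.Analysis" "HOL-Algebra.Bij" "HOL-Algebra.Generated_Groups"
begin

definition closed_annulus :: "(complex \<times> real) set"
  where "closed_annulus = sphere 0 1 \<times> {0..1}"

(* As in BijGroup, a self-map of S is represented by a function that is undefined outside S,
   so that two homeomorphisms are equal iff they agree on S. *)
definition Homeo :: "'a::topological_space set \<Rightarrow> ('a \<Rightarrow> 'a) set"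
  where "Homeo S = extensional S \<inter> {f. \<exists>g. homeomorphism S S f g}"

definition HomeoGroup :: "'a::topological_space set \<Rightarrow> ('a \<Rightarrow> 'a) monoid"
  where "HomeoGroup S = BijGroup S \<lparr>carrier := Homeo S\<rparr>"

definition finitely_generated_group :: "('a, 'b) monoid_scheme \<Rightarrow> bool"
  where "finitely_generated_group G \<longleftrightarrow>
    group G \<and> (\<exists>X. finite X \<and> X \<subseteq> carrier G \<and> generate G X = carrier G)"

definition periodic_group :: "('a, 'b) monoid_scheme \<Rightarrow> bool"
  where "periodic_group G \<longleftrightarrow>
    group G \<and> (\<forall>g\<in>carrier G. \<exists>n::nat. n > 0 \<and> g [^]\<^bsub>G\<^esub> n = \<one>\<^bsub>G\<^esub>)"

lemma Homeo_subset_Bij: "Homeo S \<subseteq> Bij S"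
  by (auto simp: Homeo_def Bij_def homeomorphism_def intro!: bij_betw_byWitness)

lemma homeomorphism_imp_restrict_Homeo:
  assumes "homeomorphism S S f g"
  shows "restrict f S \<in> Homeo S"
proof -
  have "homeomorphism S S (restrict f S) g"
    using assms by (rule homeomorphism_cong) auto
  then show ?thesis
    by (auto simp: Homeo_def)
qed

lemma subgroup_Homeo: "subgroup (Homeo S) (BijGroup S)"
proof (rule group.subgroupI[OF group_BijGroup])
  show "Homeo S \<subseteq> carrier (BijGroup S)"
    using Homeo_subset_Bij by (simp add: BijGroup_def)
  have "restrict id S \<in> Homeo S"
    by (rule homeomorphism_imp_restrict_Homeo[of _ _ id]) (auto simp: homeomorphism_def)
  then show "Homeo S \<noteq> {}"
    by blast
next
  fix f assume f: "f \<in> Homeo S"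
  then obtain g where g: "homeomorphism S S f g"
    by (auto simp: Homeo_def)
  let ?g = "restrict g S"
  have gH: "?g \<in> Homeo S"
    using g by (metis homeomorphism_imp_restrict_Homeo homeomorphism_symD)
  have "compose S ?g f = (\<lambda>x\<in>S. x)"
    using g by (auto simp: compose_def homeomorphism_def restrict_def fun_eq_iff)
  then have "?g \<otimes>\<^bsub>BijGroup S\<^esub> f = \<one>\<^bsub>BijGroup S\<^esub>"
    using f gH Homeo_subset_Bij[of S] by (auto simp: BijGroup_def)
  then have "inv\<^bsub>BijGroup S\<^esub> f = ?g"
    using f gH Homeo_subset_Bij[of S]
    by (intro group.inv_equality[OF group_BijGroup]) (auto simp: BijGroup_def)
  with gH show "inv\<^bsub>BijGroup S\<^esub> f \<in> Homeo S"
    by simp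
next
  fix f h assume f: "f \<in> Homeo S" and h: "h \<in> Homeo S"
  then obtain f' h' where "homeomorphism S S f f'" "homeomorphism S S h h'"
    by (auto simp: Homeo_def)
  then have "restrict (f \<circ> h) S \<in> Homeo S"
    by (metis homeomorphism_compose homeomorphism_imp_restrict_Homeo)
  moreover have "f \<otimes>\<^bsub>BijGroup S\<^esub> h = restrict (f \<circ> h) S"
    using f h Homeo_subset_Bij[of S] by (auto simp: BijGroup_def compose_def restrict_def fun_eq_iff)
  ultimately show "f \<otimes>\<^bsub>BijGroup S\<^esub> h \<in> Homeo S"
    by simp
qed

lemma group_HomeoGroup: "group (HomeoGroup S)"
  unfolding HomeoGroup_def
  using group.subgroup_imp_group[OF group_BijGroup subgroup_Homeo] .

end

theory Submission
  imports Defs "HOL-Computational_Algebra.Primes"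
begin

text \<open>
  Every element of \<open>\<Gamma>\<close> permutes the two boundary circles, and the theorem comes from looking at
  what it does to the outer one. The idea has a planar half and a one-dimensional half.

  The planar half is a rigidity statement in the spirit of Newman: a periodic homeomorphism of the annulus
  that is the identity on the outer circle is the identity
  (\<open>periodic_annulus_homeomorphism_fixing_circle\<close>). Coning off the inner circle turns it into a statement
  about a periodic map \<open>f\<close> of a disc that fixes the boundary circle (\<open>periodic_disc_map.fixes_all\<close>). We may
  assume that the period \<open>p\<close> is prime. If \<open>f y \<noteq> y\<close>, let \<open>G z\<close> be the average of the orbit of \<open>z\<close>, minus
  \<open>y\<close>. This function is \<open>f\<close>-invariant, equals \<open>z - y\<close> on the boundary, and vanishes at no fixed point of \<open>f\<close>,
  since at a fixed point it is again \<open>z - y\<close>. So the zeros of \<open>G\<close> lie in free orbits and, counted with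
  multiplicity, they come in groups of \<open>p\<close>. Hence the winding number of \<open>G\<close> along the boundary circle should be
  divisible by \<open>p\<close>; but it is 1. The count is made rigorous without a theory of degree: small discs that
  are disjoint from their iterates are cleared of zeros one after the other, and each time the values of
  \<open>G\<close> on the boundary circle change by a \<open>p\<close>-th power. Once no zeros are left, \<open>G\<close> has a logarithm, so
  \<open>z - y\<close> has a continuous \<open>p\<close>-th root on the boundary circle (\<open>invariant_has_root_on_boundary\<close>),
  which is impossible (\<open>no_root_of_linear_on_circle\<close>).

  The one-dimensional half concerns periodic orientation-preserving homeomorphisms of the circle, studied
  through their increasing lifts to the line. One that has a fixed point is the identity
  (\<open>periodic_circle_map_with_fixpoint_is_id\<close>), and two of them commute at some point
  (\<open>circle_maps_commute_somewhere\<close>): if the lifts satisfied \<open>\<phi> \<psi> < \<psi> \<phi>\<close> everywhere, then also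
  \<open>\<phi>\<^sup>n \<psi> < \<psi> \<phi>\<^sup>n\<close>, although \<open>\<phi>\<^sup>n\<close> is a translation by a multiple of \<open>2\<pi>\<close>.

  Let \<open>H\<close> be the set of those elements of \<open>\<Gamma>\<close> that preserve the outer circle and its orientation. Given
  \<open>g\<close> and \<open>h\<close> in \<open>H\<close>, the element \<open>(g h)\<^sup>-\<^sup>1 h g\<close> of \<open>H\<close> fixes a point of the outer circle, hence the whole
  circle, hence the annulus: \<open>H\<close> is commutative. It has at most four left cosets, told apart by the image of
  the outer circle and by the orientation. A finitely generated torsion group with such a subgroup is finite
  (\<open>finite_if_virtually_commuting_torsion\<close>).
\<close>

section \<open>Lifts of circle maps\<close>

lemma cis_eq_iff_int: "cis a = cis b \<longleftrightarrow> (\<exists>k::int. a = b + 2 * pi * k)"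
proof -
  have "(\<i> * complex_of_real a = \<i> * b + (of_int (2*n) * pi) * \<i>) \<longleftrightarrow> a = b + 2 * pi * n" for n :: int
  proof -
    have "(\<i> * complex_of_real a = \<i> * b + (of_int (2*n) * pi) * \<i>)
        \<longleftrightarrow> \<i> * complex_of_real a = \<i> * complex_of_real (b + 2 * pi * n)"
      by (simp add: algebra_simps)
    also have "\<dots> \<longleftrightarrow> a = b + 2 * pi * n"
      by (simp only: mult_cancel_left of_real_eq_iff) simp
    finally show ?thesis .
  qed
  then show ?thesis
    unfolding cis_conv_exp exp_eq by simp
qed

text \<open>
  Applied to the difference of two continuous logarithms of one function, this gives the uniqueness of lifts.
\<close>
lemma continuous_exp_eq_1_imp_constant:
  fixes f :: "'a::topological_space \<Rightarrow> complex"
  assumes "connected S" "continuous_on S f" "\<And>x. x \<in> S \<Longrightarrow> exp (f x) = 1"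
  shows "\<exists>k::int. \<forall>x\<in>S. f x = of_int (2 * k) * pi * \<i>"
proof -
  have sep: "2 * pi \<le> norm (f y - f x)" if "x \<in> S" "y \<in> S" "f y \<noteq> f x" for x y
  proof -
    have "exp (f x) = exp (f y)"
      using assms(3) that by simp
    then show ?thesis
      using exp_complex_eqI[of "f y" "f x"] abs_Im_le_cmod[of "f y - f x"] that by fastforce
  qed
  have "f constant_on S"
  proof (rule continuous_discrete_range_constant[OF assms(1,2)])
    show "\<exists>e>0. \<forall>y. y \<in> S \<and> f y \<noteq> f x \<longrightarrow> e \<le> norm (f y - f x)" if "x \<in> S" for x
      using sep[OF that] by (intro exI[of _ "2 * pi"]) auto
  qed
  then obtain c where c: "\<And>x. x \<in> S \<Longrightarrow> f x = c"
    by (auto simp: constant_on_def)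
  show ?thesis
  proof (cases "S = {}")
    case False
    then have "exp c = exp 0"
      using assms(3) c by auto
    then obtain k :: int where "c = 0 + of_int (2 * k) * pi * \<i>"
      unfolding exp_eq by blast
    then show ?thesis
      using c by (intro exI[of _ k]) simp
  qed auto
qed

text \<open>
  Here \<open>u\<close> stands for a map of the unit circle. The covering is \<open>x \<mapsto> cis x\<close>, so the deck
  transformations are the translations by multiples of \<open>2\<pi>\<close>.
\<close>
definition circle_lift :: "(real \<Rightarrow> real) \<Rightarrow> (complex \<Rightarrow> complex) \<Rightarrow> bool"
  where "circle_lift \<phi> u \<longleftrightarrow> continuous_on UNIV \<phi> \<and> (\<forall>x. cis (\<phi> x) = u (cis x))"

lemma continuous_on_cis_real: "continuous_on S cis"
  by (intro continuous_intros)

lemma complex_unit_eq_cis: "z \<in> sphere 0 1 \<Longrightarrow> \<exists>x. z = cis x"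
  using rcis_cmod_Arg[of z] by (auto simp: rcis_def intro: exI[of _ "Arg z"])

lemma circle_lift_exists:
  assumes "continuous_on (sphere 0 1) u" "u ` sphere 0 1 \<subseteq> sphere 0 1"
  shows "\<exists>\<phi>. circle_lift \<phi> u"
proof -
  have un: "norm (u (cis x)) = 1" for x
    using assms(2) by (auto simp: image_subset_iff)
  have "continuous_on UNIV (u \<circ> cis)"
    by (intro continuous_on_compose continuous_on_cis_real continuous_on_subset[OF assms(1)]) auto
  moreover have "contractible (UNIV :: real set)"
    by (simp add: convex_imp_contractible)
  moreover have "(u \<circ> cis) x \<noteq> 0" for x
    using un[of x] by auto
  ultimately obtain L where L: "continuous_on UNIV L" "\<And>x. (u \<circ> cis) x = exp (L x)"
    using continuous_logarithm_on_contractible[of UNIV "u \<circ> cis"] by auto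
  have "exp (Re (L x)) = 1" for x
    using un[of x] L(2)[of x] by simp
  then have "L x = \<i> * Im (L x)" for x
    by (simp add: complex_eq_iff)
  then have "cis (Im (L x)) = u (cis x)" for x
    using L(2)[of x] by (metis cis_conv_exp comp_apply)
  moreover have "continuous_on UNIV (\<lambda>x. Im (L x))"
    by (intro continuous_intros L)
  ultimately show ?thesis
    unfolding circle_lift_def by blast
qed

lemma circle_lift_unique:
  assumes "circle_lift \<phi> u" "circle_lift \<psi> v" "\<And>z. z \<in> sphere 0 1 \<Longrightarrow> u z = v z"
  shows "\<exists>k::int. \<forall>x. \<phi> x = \<psi> x + 2 * pi * k"
proof -
  have "continuous_on UNIV (\<lambda>x. \<i> * complex_of_real (\<phi> x - \<psi> x))"
    using assms by (intro continuous_intros) (auto simp: circle_lift_def)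
  moreover have "exp (\<i> * complex_of_real (\<phi> x - \<psi> x)) = 1" for x
  proof -
    have "cis (\<phi> x) = cis (\<psi> x)"
      using assms by (auto simp: circle_lift_def)
    then have "cis (\<phi> x - \<psi> x) = 1"
      by (simp flip: cis_divide)
    then show ?thesis
      by (simp add: cis_conv_exp)
  qed
  ultimately obtain k :: int where k: "\<And>x. \<i> * complex_of_real (\<phi> x - \<psi> x) = of_int (2 * k) * pi * \<i>"
    using continuous_exp_eq_1_imp_constant[of UNIV "\<lambda>x. \<i> * complex_of_real (\<phi> x - \<psi> x)"] by auto
  have "\<phi> x = \<psi> x + 2 * pi * k" for x
    using arg_cong[OF k[of x], of Im] by (simp add: algebra_simps)
  then show ?thesis
    by blast
qed

lemma circle_lift_compose:
  assumes "circle_lift \<phi> u" "circle_lift \<psi> v"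
  shows "circle_lift (\<phi> \<circ> \<psi>) (u \<circ> v)"
  using assms unfolding circle_lift_def o_def
  by (auto intro!: continuous_on_compose2[of UNIV \<phi>])

lemma circle_lift_id: "circle_lift id id"
  by (auto simp: circle_lift_def)

lemma circle_lift_funpow:
  assumes "circle_lift \<phi> u"
  shows "circle_lift (\<phi> ^^ n) (u ^^ n)"
proof (induction n)
  case 0
  show ?case
    unfolding funpow.simps by (rule circle_lift_id)
next
  case (Suc n)
  show ?case
    using circle_lift_compose[OF assms Suc] by (simp only: funpow.simps)
qed

text \<open>
  The integer \<open>d\<close> is the degree of the circle map.
\<close>
lemma circle_lift_translate:
  assumes "circle_lift \<phi> u"
  shows "\<exists>d::int. \<forall>x. \<forall>k::int. \<phi> (x + 2 * pi * k) = \<phi> x + 2 * pi * of_int (d * k)"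
proof -
  have "circle_lift (\<lambda>x. \<phi> (x + 2 * pi)) u"
    using assms unfolding circle_lift_def
    by (auto intro!: continuous_on_compose2[of UNIV \<phi>] continuous_intros simp: cis_mult[symmetric])
  then obtain d :: int where d: "\<And>x. \<phi> (x + 2 * pi) = \<phi> x + 2 * pi * d"
    using circle_lift_unique[OF _ assms] by blast
  have "\<phi> (x + 2 * pi * k) = \<phi> x + 2 * pi * of_int (d * k)" for x and k :: int
  proof (induction k rule: int_induct[of _ 0])
    case (step1 i)
    then show ?case
      using d[of "x + 2 * pi * i"] by (simp add: algebra_simps)
  next
    case (step2 i)
    then show ?case
      using d[of "x + 2 * pi * (i - 1)"] by (simp add: algebra_simps)
  qed simp
  then show ?thesis
    by (intro exI[of _ d]) blast
qed

text \<open>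
  A point where the lift repeats a value gives two points of the line over the same point of the circle, so
  they differ by \<open>2\<pi>k\<close>, and the lift takes different values there unless the degree is 0. Degree 0 is
  excluded because the lift would be strictly monotone on a half-open period and yet return to its initial value.
\<close>
lemma circle_lift_monotone:
  assumes \<phi>: "circle_lift \<phi> u" and inj: "inj_on u (sphere 0 1)"
  shows "strict_mono \<phi> \<or> strict_antimono_on UNIV \<phi>"
proof -
  have cont: "continuous_on S \<phi>" for S
    using \<phi> continuous_on_subset by (auto simp: circle_lift_def)
  have cisinj: "\<exists>k::int. x = y + 2 * pi * k" if "\<phi> x = \<phi> y" for x y
  proof -
    have "u (cis x) = u (cis y)"
      using that \<phi> by (metis circle_lift_def)
    then have "cis x = cis y"
      using inj by (auto simp: inj_on_def)
    then show ?thesis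
      by (simp add: cis_eq_iff_int)
  qed
  obtain d :: int where d: "\<And>x k. \<phi> (x + 2 * pi * of_int k) = \<phi> x + 2 * pi * of_int (d * k)"
    using circle_lift_translate[OF \<phi>] by blast
  have "d \<noteq> 0"
  proof
    assume "d = 0"
    then have per: "\<phi> (2 * pi) = \<phi> 0"
      using d[of 0 1] by simp
    have "inj_on \<phi> {0..<2 * pi}"
    proof (rule inj_onI)
      fix x y assume xy: "x \<in> {0..<2 * pi}" "y \<in> {0..<2 * pi}" "\<phi> x = \<phi> y"
      then obtain k :: int where k: "x = y + 2 * pi * k"
        using cisinj by blast
      have "2 * pi * real_of_int k < 2 * pi * 1" "2 * pi * (-1) < 2 * pi * real_of_int k"
        using xy k unfolding atLeastLessThan_iff by linarith+
      then have "real_of_int k < 1" "-1 < real_of_int k"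
        by (simp_all only: mult_less_cancel_left_pos[of "2 * pi"] mult_pos_pos pi_gt_zero zero_less_numeral)
      then show "x = y"
        using k by simp
    qed
    moreover have "is_interval {0..<2 * pi}"
      by (simp add: is_interval_co)
    ultimately consider "strict_mono_on {0..<2 * pi} \<phi>" | "strict_antimono_on {0..<2 * pi} \<phi>"
      using injective_eq_monotone_map cont by blast
    then show False
    proof cases
      case 1
      have "\<phi> pi \<le> \<phi> (2 * pi)"
      proof (rule continuous_ge_on_closure[OF cont, of _ "{pi<..<2 * pi}"])
        show "\<phi> pi \<le> \<phi> x" if "x \<in> {pi<..<2 * pi}" for x
          using monotone_onD[OF 1, of pi x] that by auto
      qed auto
      moreover have "\<phi> 0 < \<phi> pi"
        using monotone_onD[OF 1, of 0 pi] by auto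
      ultimately show False
        using per by simp
    next
      case 2
      have "\<phi> (2 * pi) \<le> \<phi> pi"
      proof (rule continuous_le_on_closure[OF cont, of _ "{pi<..<2 * pi}"])
        show "\<phi> x \<le> \<phi> pi" if "x \<in> {pi<..<2 * pi}" for x
          using monotone_onD[OF 2, of pi x] that by auto
      qed auto
      moreover have "\<phi> pi < \<phi> 0"
        using monotone_onD[OF 2, of 0 pi] by auto
      ultimately show False
        using per by simp
    qed
  qed
  have "inj \<phi>"
  proof (rule injI)
    fix x y assume "\<phi> x = \<phi> y"
    moreover obtain k :: int where k: "x = y + 2 * pi * k"
      using cisinj calculation by blast
    ultimately show "x = y"
      using d[of y k] \<open>d \<noteq> 0\<close> by simp
  qed
  then show ?thesis
    using injective_eq_monotone_map[of UNIV \<phi>] cont by simp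
qed

lemma periodic_lift_is_translation:
  assumes "circle_lift \<phi> u" "\<And>z. z \<in> sphere 0 1 \<Longrightarrow> (u ^^ n) z = z"
  shows "\<exists>m::int. \<forall>x. (\<phi> ^^ n) x = x + 2 * pi * m"
  using circle_lift_unique[OF circle_lift_funpow[OF assms(1), of n] circle_lift_id] assms(2) by simp

lemma strict_mono_funpow_id_imp_id:
  fixes f :: "real \<Rightarrow> real"
  assumes "strict_mono f" "(f ^^ n) x = x" "n > 0"
  shows "f x = x"
proof (rule ccontr)
  assume ne: "f x \<noteq> x"
  obtain k where k: "n = Suc k"
    using \<open>n > 0\<close> gr0_conv_Suc by auto
  from ne consider "f x < x" | "f x > x" by linarith
  then show False
  proof cases
    case 1
    then have "(f ^^ Suc k) x < x" for k
    proof (induction k)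
      case (Suc k)
      then have "f ((f ^^ Suc k) x) < f x"
        using assms(1) by (auto simp: strict_mono_def)
      then show ?case
        using 1 by simp
    qed simp
    then show False
      using assms k by (metis less_irrefl)
  next
    case 2
    then have "(f ^^ Suc k) x > x" for k
    proof (induction k)
      case (Suc k)
      then have "f ((f ^^ Suc k) x) > f x"
        using assms(1) by (auto simp: strict_mono_def)
      then show ?case
        using 2 by simp
    qed simp
    then show False
      using assms k by (metis less_irrefl)
  qed
qed

text \<open>
  The lift can be chosen to fix a point over the fixed point. Its \<open>n\<close>-th iterate is then a translation
  with a fixed point, so the identity, and an increasing map of finite order on the line is the identity.
\<close>
lemma periodic_circle_map_with_fixpoint_is_id:
  assumes \<phi>: "circle_lift \<phi> u" "strict_mono \<phi>"
    and per: "n > 0" "\<And>z. z \<in> sphere 0 1 \<Longrightarrow> (u ^^ n) z = z"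
    and fixp: "a \<in> sphere 0 1" "u a = a" and z: "z \<in> sphere 0 1"
  shows "u z = z"
proof -
  obtain x0 where x0: "a = cis x0"
    using complex_unit_eq_cis fixp by blast
  then have "cis (\<phi> x0) = cis x0"
    using \<phi> fixp by (auto simp: circle_lift_def)
  then obtain j :: int where j: "\<phi> x0 = x0 + 2 * pi * j"
    using cis_eq_iff_int by blast
  \<comment> \<open>the lift that fixes \<open>x0\<close>\<close>
  define \<psi> where "\<psi> = (\<lambda>x. \<phi> x - 2 * pi * j)"
  have "cis (\<phi> x - 2 * pi * j) = cis (\<phi> x)" for x
    by (auto simp: cis_eq_iff_int intro: exI[of _ "-j"])
  then have \<psi>: "circle_lift \<psi> u"
    using \<phi> unfolding circle_lift_def \<psi>_def by (auto intro!: continuous_intros)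
  have mono: "strict_mono \<psi>"
    using \<phi>(2) by (auto simp: strict_mono_def \<psi>_def)
  have "\<psi> x0 = x0"
    by (simp add: \<psi>_def j)
  then have "(\<psi> ^^ n) x0 = x0"
    by (induction n) auto
  moreover obtain m :: int where "\<And>x. (\<psi> ^^ n) x = x + 2 * pi * m"
    using periodic_lift_is_translation[OF \<psi> per(2)] by blast
  ultimately have "(\<psi> ^^ n) x = x" for x
    by simp
  then have "\<psi> x = x" for x
    using strict_mono_funpow_id_imp_id[OF mono _ per(1)] by blast
  then show ?thesis
    using \<psi> z complex_unit_eq_cis by (metis circle_lift_def)
qed

text \<open>
  If the degree is \<open>d\<close>, then the \<open>n\<close>-th iterate has degree \<open>d ^ n\<close>; but it is a translation, which
  has degree 1, and \<open>d > 0\<close> because the lift is increasing.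
\<close>
lemma periodic_lift_commutes_with_translation:
  assumes \<psi>: "circle_lift \<psi> v" "strict_mono \<psi>"
    and per: "n > 0" "\<And>z. z \<in> sphere 0 1 \<Longrightarrow> (v ^^ n) z = z"
  shows "\<psi> (x + 2 * pi * of_int k) = \<psi> x + 2 * pi * of_int k"
proof -
  obtain d :: int where d: "\<And>x k. \<psi> (x + 2 * pi * of_int k) = \<psi> x + 2 * pi * of_int (d * k)"
    using circle_lift_translate[OF \<psi>(1)] by blast
  obtain m :: int where m: "\<And>x. (\<psi> ^^ n) x = x + 2 * pi * m"
    using periodic_lift_is_translation[OF \<psi>(1) per(2)] by blast
  have "(\<psi> ^^ j) (2 * pi) = (\<psi> ^^ j) 0 + 2 * pi * of_int (d ^ j)" for j
  proof (induction j)
    case (Suc j)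
    then show ?case
      using d[of "(\<psi> ^^ j) 0" "d ^ j"] by (simp add: algebra_simps)
  qed simp
  from this[of n] have "real_of_int (d ^ n) = 1"
    by (simp add: m)
  then have "d ^ n = 1"
    by linarith
  then have "\<bar>d\<bar> = 1"
    using per(1) by (metis abs_1 abs_ge_zero gr0_conv_Suc power_abs power_eq_1_iff zabs_less_one_iff power_eq_iff_eq_base one_power2 power_one zero_le_one)
  moreover have "\<psi> 0 < \<psi> (0 + 2 * pi * of_int 1)"
    using \<psi>(2) by (auto simp: strict_mono_def)
  then have "d > 0"
    unfolding d by (simp add: zero_less_mult_iff)
  ultimately have "d = 1"
    by simp
  then show ?thesis
    using d by simp
qed

text \<open>
  This is the argument by which roots are unique in a bi-ordered group. If \<open>u v\<close> and \<open>v u\<close> agreed nowhere,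
  then the difference of the two composed lifts would have constant sign, say \<open>\<phi> \<psi> < \<psi> \<phi>\<close>. Applying \<open>\<phi>\<close> and
  the inequality in turn gives \<open>\<phi>\<^sup>j \<psi> < \<psi> \<phi>\<^sup>j\<close> for all \<open>j \<ge> 1\<close>. For \<open>j = n\<close> the map \<open>\<phi>\<^sup>j\<close> is a translation
  that commutes with \<open>\<psi>\<close>, a contradiction.
\<close>
lemma circle_maps_commute_somewhere:
  assumes \<phi>: "circle_lift \<phi> u" "strict_mono \<phi>"
    and u: "n > 0" "\<And>z. z \<in> sphere 0 1 \<Longrightarrow> (u ^^ n) z = z"
    and \<psi>: "circle_lift \<psi> v" "strict_mono \<psi>"
    and v: "l > 0" "\<And>z. z \<in> sphere 0 1 \<Longrightarrow> (v ^^ l) z = z"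
  shows "\<exists>z\<in>sphere 0 1. u (v z) = v (u z)"
proof (rule ccontr)
  assume none: "\<not> ?thesis"
  have ne: "\<phi> (\<psi> x) \<noteq> \<psi> (\<phi> x)" for x
  proof
    assume "\<phi> (\<psi> x) = \<psi> (\<phi> x)"
    then have "u (v (cis x)) = v (u (cis x))"
      using \<phi> \<psi> by (metis circle_lift_def)
    then show False
      using none by auto
  qed
  obtain m :: int where m: "\<And>x. (\<phi> ^^ n) x = x + 2 * pi * m"
    using periodic_lift_is_translation[OF \<phi>(1) u(2)] by blast
  have comm: "(\<phi> ^^ n) (\<psi> x) = \<psi> ((\<phi> ^^ n) x)" for x
    unfolding m using periodic_lift_commutes_with_translation[OF \<psi> v] by metis
  define D where "D = (\<lambda>x. \<phi> (\<psi> x) - \<psi> (\<phi> x))"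
  have "continuous_on UNIV D"
    using \<phi> \<psi> unfolding D_def circle_lift_def
    by (auto intro!: continuous_intros intro: continuous_on_compose2[of UNIV])
  then have "connected (range D)"
    by (intro connected_continuous_image) auto
  moreover have "0 \<notin> range D"
    using ne by (auto simp: D_def)
  ultimately consider "\<And>x. D x > 0" | "\<And>x. D x < 0"
    by (metis (no_types, lifting) connectedD_interval not_less_iff_gr_or_eq order_less_imp_le rangeI)
  then show False
  proof cases
    case 1
    have "(\<phi> ^^ Suc j) (\<psi> x) > \<psi> ((\<phi> ^^ Suc j) x)" for j x
    proof (induction j)
      case 0
      then show ?case
        using 1[of x] by (simp add: D_def)
    next
      case (Suc j)
      have "\<psi> (\<phi> ((\<phi> ^^ Suc j) x)) < \<phi> (\<psi> ((\<phi> ^^ Suc j) x))"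
        using 1[of "(\<phi> ^^ Suc j) x"] by (simp add: D_def)
      also have "\<dots> < \<phi> ((\<phi> ^^ Suc j) (\<psi> x))"
        using Suc \<phi>(2) by (auto simp: strict_mono_def)
      finally show ?case
        by simp
    qed
    from this[of "n - 1"] comm show False
      using u(1) by (metis Suc_diff_1 less_irrefl)
  next
    case 2
    have "(\<phi> ^^ Suc j) (\<psi> x) < \<psi> ((\<phi> ^^ Suc j) x)" for j x
    proof (induction j)
      case 0
      then show ?case
        using 2[of x] by (simp add: D_def)
    next
      case (Suc j)
      have "\<phi> ((\<phi> ^^ Suc j) (\<psi> x)) < \<phi> (\<psi> ((\<phi> ^^ Suc j) x))"
        using Suc \<phi>(2) by (auto simp: strict_mono_def)
      also have "\<dots> < \<psi> (\<phi> ((\<phi> ^^ Suc j) x))"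
        using 2[of "(\<phi> ^^ Suc j) x"] by (simp add: D_def)
      finally show ?case
        by simp
    qed
    from this[of "n - 1"] comm show False
      using u(1) by (metis Suc_diff_1 less_irrefl)
  qed
qed

section \<open>Nonvanishing functions on a circle\<close>

text \<open>
  Here \<open>n\<close> is the winding number of \<open>g\<close>. A logarithm of \<open>g\<close> along the parametrised circle increases by
  \<open>2\<pi>\<i>n\<close> over a period, so subtracting \<open>n\<close> times a logarithm of the parametrisation \<open>z - c\<close> leaves a periodic
  function \<open>W\<close>, which descends to the circle.
\<close>
lemma nonvanishing_on_circle_eq_power_times_exp:
  fixes g :: "complex \<Rightarrow> complex"
  assumes r: "0 < r" and cont: "continuous_on (sphere c r) g"
    and nz: "\<And>z. z \<in> sphere c r \<Longrightarrow> g z \<noteq> 0"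
  shows "\<exists>n v. continuous_on (sphere c r) v \<and> (\<forall>z\<in>sphere c r. g z = (z - c) powi n * exp (v z))"
proof -
  define \<gamma> where "\<gamma> = (\<lambda>x. c + of_real r * cis x)"
  have \<gamma>: "\<gamma> x \<in> sphere c r" for x
    using r by (simp add: \<gamma>_def dist_norm norm_mult)
  have "continuous_on UNIV (\<lambda>x. g (\<gamma> x))"
    using \<gamma> unfolding \<gamma>_def
    by (intro continuous_on_compose2[OF cont] continuous_intros) auto
  moreover have "contractible (UNIV :: real set)"
    by (simp add: convex_imp_contractible)
  ultimately obtain L where L: "continuous_on UNIV L" "\<And>x. g (\<gamma> x) = exp (L x)"
    using continuous_logarithm_on_contractible[of UNIV "\<lambda>x. g (\<gamma> x)"] nz \<gamma> by auto
  have "continuous_on UNIV (\<lambda>x. L (x + 2 * pi) - L x)"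
    by (intro continuous_intros continuous_on_compose2[OF L(1)]) auto
  moreover have "exp (L (x + 2 * pi) - L x) = 1" for x
  proof -
    have "\<gamma> (x + 2 * pi) = \<gamma> x"
      by (simp add: \<gamma>_def flip: cis_mult)
    then have "exp (L (x + 2 * pi)) = exp (L x)"
      using L(2) by metis
    then show ?thesis
      by (simp add: exp_diff)
  qed
  ultimately obtain n :: int where n: "\<And>x. L (x + 2 * pi) - L x = of_int (2 * n) * pi * \<i>"
    using continuous_exp_eq_1_imp_constant[of UNIV "\<lambda>x. L (x + 2 * pi) - L x"] by auto
  define W where "W = (\<lambda>x. L x - of_int n * (of_real (ln r) + \<i> * of_real x))"
  have W: "continuous_on UNIV W"
    unfolding W_def by (intro continuous_intros L)
  have Wper: "W (x + 2 * pi) = W x" for x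
    using n[of x] by (simp add: W_def algebra_simps)
  \<comment> \<open>As \<open>W\<close> is periodic, either branch of the argument may be used, and at each point one of
    the two is continuous.\<close>
  define v where "v = (\<lambda>z. W (Arg2pi (z - c)))"
  have v_Arg: "v z = W (Arg (z - c))" for z
  proof (cases "z = c")
    case True
    then show ?thesis
      by (simp add: v_def Arg2pi_eq_0 Arg_zero)
  next
    case False
    have "of_real (cmod (z - c)) * cis (Arg2pi (z - c)) = of_real (cmod (z - c)) * cis (Arg (z - c))"
      using Arg2pi_eq[of "z - c"] rcis_cmod_Arg[of "z - c"] by (simp add: cis_conv_exp rcis_def)
    then have "cis (Arg2pi (z - c)) = cis (Arg (z - c))"
      using False by simp
    then obtain k :: int where k: "Arg2pi (z - c) = Arg (z - c) + 2 * pi * k"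
      by (auto simp: cis_eq_iff_int)
    have "W (x + 2 * pi * of_int k) = W x" for x k
    proof (induction k rule: int_induct[of _ 0])
      case (step1 i)
      then show ?case
        using Wper[of "x + 2 * pi * i"] by (simp add: algebra_simps)
    next
      case (step2 i)
      then show ?case
        using Wper[of "x + 2 * pi * (i - 1)"] by (simp add: algebra_simps)
    qed simp
    then show ?thesis
      by (simp add: v_def k)
  qed
  have contW: "isCont W x" for x
    using W by (simp add: continuous_on_eq_continuous_at)
  have "continuous_on (sphere c r) v"
    unfolding continuous_on_eq_continuous_within
  proof
    fix z assume z: "z \<in> sphere c r"
    then have "z - c \<noteq> 0"
      using r by auto
    then have "\<not> (z - c \<in> \<real>\<^sub>\<le>\<^sub>0 \<and> z - c \<in> \<real>\<^sub>\<ge>\<^sub>0)"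
      by (auto simp: complex_nonpos_Reals_iff complex_nonneg_Reals_iff complex_eq_iff)
    then consider "z - c \<notin> \<real>\<^sub>\<le>\<^sub>0" | "z - c \<notin> \<real>\<^sub>\<ge>\<^sub>0"
      by blast
    then have "isCont v z"
    proof cases
      case 1
      have "isCont (\<lambda>z. W (Arg (z - c))) z"
        using isCont_o2[where f = "\<lambda>z. z - c" and a = z and g = Arg] continuous_at_Arg[OF 1] contW
        by (intro isCont_o2[where f = "\<lambda>z. Arg (z - c)" and g = W]) auto
      then show ?thesis
        by (simp add: v_Arg[abs_def])
    next
      case 2
      show ?thesis
        unfolding v_def
        using isCont_o2[where f = "\<lambda>z. z - c" and a = z and g = Arg2pi] continuous_at_Arg2pi[OF 2] contW
        by (intro isCont_o2[where f = "\<lambda>z. Arg2pi (z - c)" and g = W]) auto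
    qed
    then show "continuous (at z within sphere c r) v"
      using continuous_at_imp_continuous_at_within by blast
  qed
  moreover have "g z = (z - c) powi n * exp (v z)" if z: "z \<in> sphere c r" for z
  proof -
    define x where "x = Arg2pi (z - c)"
    have zc: "z - c = of_real r * exp (\<i> * of_real x)"
      using z Arg2pi_eq[of "z - c"] r by (simp add: x_def dist_norm norm_minus_commute)
    then have "\<gamma> x = z"
      by (simp add: \<gamma>_def cis_conv_exp algebra_simps)
    then have "g z = exp (L x)"
      using L(2) by metis
    also have "\<dots> = exp (of_int n * (of_real (ln r) + \<i> * of_real x)) * exp (v z)"
      by (simp add: v_def W_def x_def flip: exp_add)
    also have "exp (of_int n * (of_real (ln r) + \<i> * of_real x)) = exp (of_real (ln r) + \<i> * of_real x) powi n"
      by (simp add: exp_power_int)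
    also have "exp (of_real (ln r) + \<i> * of_real x) = z - c"
      using r by (simp add: zc exp_add exp_of_real)
    finally show ?thesis .
  qed
  ultimately show ?thesis
    by blast
qed

lemma powi_eq_exp_on_circle_imp_0:
  fixes v :: "complex \<Rightarrow> complex"
  assumes R: "0 < R" and cont: "continuous_on (sphere 0 R) v"
    and eq: "\<And>z. z \<in> sphere 0 R \<Longrightarrow> z powi k = exp (v z)"
  shows "k = 0"
proof -
  define \<gamma> where "\<gamma> = (\<lambda>x. of_real R * cis x)"
  have \<gamma>: "\<gamma> x \<in> sphere 0 R" for x
    using R by (simp add: \<gamma>_def norm_mult)
  have "continuous_on UNIV (\<lambda>x. v (\<gamma> x) - of_int k * (of_real (ln R) + \<i> * of_real x))"
    using \<gamma> unfolding \<gamma>_def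
    by (intro continuous_intros continuous_on_compose2[OF cont]) auto
  moreover have "exp (v (\<gamma> x) - of_int k * (of_real (ln R) + \<i> * of_real x)) = 1" for x
  proof -
    have "exp (of_int k * (of_real (ln R) + \<i> * of_real x)) = exp (of_real (ln R) + \<i> * of_real x) powi k"
      by (simp add: exp_power_int)
    also have "exp (of_real (ln R) + \<i> * of_real x) = \<gamma> x"
      using R by (simp add: \<gamma>_def exp_add exp_of_real cis_conv_exp)
    also have "\<gamma> x powi k = exp (v (\<gamma> x))"
      by (rule eq[OF \<gamma>])
    finally show ?thesis
      by (simp add: exp_diff)
  qed
  ultimately obtain j :: int where
    j: "\<And>x. v (\<gamma> x) - of_int k * (of_real (ln R) + \<i> * of_real x) = of_int (2 * j) * pi * \<i>"
    using continuous_exp_eq_1_imp_constant[of UNIV "\<lambda>x. v (\<gamma> x) - of_int k * (of_real (ln R) + \<i> * of_real x)"]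
    by auto
  have "\<gamma> 0 = \<gamma> (2 * pi)"
    by (simp add: \<gamma>_def)
  then have "of_int k * (of_real (2 * pi) :: complex) = 0"
    using j[of 0] j[of "2 * pi"] by (simp add: algebra_simps)
  then show "k = 0"
    by simp
qed

text \<open>
  The winding number of \<open>z - y\<close> around the circle is 1, while that of a \<open>p\<close>-th power is divisible by \<open>p\<close>.
\<close>
lemma no_root_of_linear_on_circle:
  fixes q :: "complex \<Rightarrow> complex"
  assumes y: "norm y < R" and p: "p > 1"
    and cont: "continuous_on (sphere 0 R) q"
    and q: "\<And>z. z \<in> sphere 0 R \<Longrightarrow> q z ^ p = z - y"
  shows False
proof -
  have R: "0 < R"
    using y norm_ge_zero[of y] by linarith
  have "q z \<noteq> 0" if "z \<in> sphere 0 R" for z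
    using q[OF that] that y p by (auto simp: power_0_left)
  then obtain n v where v: "continuous_on (sphere 0 R) v"
    and qv: "\<And>z. z \<in> sphere 0 R \<Longrightarrow> q z = z powi n * exp (v z)"
    using nonvanishing_on_circle_eq_power_times_exp[OF R cont] by auto
  \<comment> \<open>\<open>z - y = z (1 - y / z)\<close>, and the second factor has a logarithm since \<open>y\<close> lies inside the circle.\<close>
  define w where "w = (\<lambda>z. Ln (1 - y / z) - of_nat p * v z)"
  have pos: "0 < Re (1 - y / z)" if "z \<in> sphere 0 R" for z
  proof -
    have "norm (y / z) < 1"
      using that y R by (simp add: norm_divide)
    then show ?thesis
      using abs_Re_le_cmod[of "y / z"] by simp
  qed
  have nonpos: "1 - y / z \<notin> \<real>\<^sub>\<le>\<^sub>0" if "z \<in> sphere 0 R" for z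
    using pos[OF that] by (simp only: complex_nonpos_Reals_iff) linarith
  have "continuous_on (sphere 0 R) w"
    unfolding w_def using R
    by (intro continuous_intros v nonpos) auto
  moreover have "z powi (int p * n - 1) = exp (w z)" if z: "z \<in> sphere 0 R" for z
  proof -
    have z0: "z \<noteq> 0"
      using z R by auto
    have "z - y = (z powi n) ^ p * exp (v z) ^ p"
      using q[OF z] qv[OF z] by (simp add: power_mult_distrib)
    also have "(z powi n) ^ p = z powi (int p * n)"
      by (subst mult.commute) (simp add: power_int_mult)
    also have "exp (v z) ^ p = exp (of_nat p * v z)"
      by (simp add: exp_of_nat_mult)
    finally have "z powi (int p * n) = (z - y) / exp (of_nat p * v z)"
      by simp
    then have "z powi (int p * n - 1) = (1 - y / z) / exp (of_nat p * v z)"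
      using z0 by (simp add: power_int_diff field_simps)
    also have "\<dots> = exp (w z)"
      using nonpos[OF z] by (subst w_def, subst exp_diff, subst exp_Ln) auto
    finally show ?thesis .
  qed
  ultimately have "int p * n - 1 = 0"
    by (rule powi_eq_exp_on_circle_imp_0[OF R])
  then have "int p dvd 1"
    by (intro dvdI[of _ _ n]) simp
  then show False
    using p by simp
qed

section \<open>Invariant functions on a disc with a periodic map\<close>

text \<open>
  A polynomial map sends the circle, a null set, to a null set, so an arbitrarily small constant can be
  subtracted to make it avoid 0.
\<close>
lemma nonvanishing_approximation_on_circle:
  fixes G :: "complex \<Rightarrow> complex"
  assumes "compact S" "continuous_on S G" "\<epsilon> > 0"
  shows "\<exists>P. continuous_on S P \<and> (\<forall>z\<in>S. norm (P z - G z) < \<epsilon>) \<and> (\<forall>z\<in>sphere c r. P z \<noteq> 0)"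
proof -
  obtain Q where Q: "polynomial_function Q" "\<And>z. z \<in> S \<Longrightarrow> norm (G z - Q z) < \<epsilon> / 2"
    using Stone_Weierstrass_polynomial_function[OF assms(1,2), of "\<epsilon> / 2"] assms(3) by auto
  have "negligible (Q ` sphere c r)"
    using differentiable_on_polynomial_function[OF Q(1)]
    by (intro negligible_differentiable_image_negligible negligible_sphere) auto
  then have "\<not> ball 0 (\<epsilon> / 2) \<subseteq> Q ` sphere c r"
    using assms(3) negligible_subset[of "Q ` sphere c r" "ball 0 (\<epsilon> / 2)"]
      open_not_negligible[of "ball (0::complex) (\<epsilon> / 2)"] by fastforce
  then obtain a where "a \<in> ball 0 (\<epsilon> / 2)" and a_notin: "a \<notin> Q ` sphere c r"
    by blast
  then have a: "norm a < \<epsilon> / 2"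
    by simp
  define P where "P = (\<lambda>z. Q z - a)"
  have "continuous_on S P"
    unfolding P_def using continuous_on_polymonial_function[OF Q(1)]
    by (intro continuous_intros) (auto intro: continuous_on_subset)
  moreover have "norm (P z - G z) < \<epsilon>" if "z \<in> S" for z
    using norm_triangle_ineq4[of "Q z - G z" a] Q(2)[OF that] a
    by (simp add: P_def norm_minus_commute algebra_simps)
  ultimately show ?thesis
    using a_notin by (intro exI[of _ P]) (auto simp: P_def)
qed

locale periodic_disc_map =
  fixes f :: "complex \<Rightarrow> complex" and R :: real and p :: nat
  assumes p_pos: "p > 0"
    and continuous: "continuous_on (cball 0 R) f"
    and maps: "f ` cball 0 R \<subseteq> cball 0 R"
    and periodic: "z \<in> cball 0 R \<Longrightarrow> (f ^^ p) z = z"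
    and boundary: "z \<in> sphere 0 R \<Longrightarrow> f z = z"
begin

lemma iterate_maps: "z \<in> cball 0 R \<Longrightarrow> (f ^^ i) z \<in> cball 0 R"
  using maps by (induction i) (auto simp: image_subset_iff)

lemma iterate_continuous: "continuous_on (cball 0 R) (f ^^ i)"
proof (induction i)
  case (Suc i)
  then show ?case
    using iterate_maps unfolding funpow.simps
    by (intro continuous_on_compose continuous_on_subset[OF continuous]) auto
qed (auto simp: continuous_on_id)

lemma iterate_boundary: "z \<in> sphere 0 R \<Longrightarrow> (f ^^ i) z = z"
  by (induction i) (auto simp: boundary)

definition invariant :: "(complex \<Rightarrow> complex) \<Rightarrow> bool"
  where "invariant G \<longleftrightarrow> continuous_on (cball 0 R) G \<and> (\<forall>z\<in>cball 0 R. G (f z) = G z)"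

text \<open>
  Since the \<open>p\<close> iterates of such a disc under \<open>f\<close> are pairwise disjoint, a function can be modified on the disc and
  the modification be copied to the iterates.
\<close>
definition displaced_disc :: "complex \<Rightarrow> real \<Rightarrow> bool"
  where "displaced_disc c r \<longleftrightarrow> 0 < r \<and> cball c r \<subseteq> ball 0 R \<and>
    (\<forall>i z. 0 < i \<longrightarrow> i < p \<longrightarrow> z \<in> cball c r \<longrightarrow> (f ^^ i) z \<notin> cball c r)"

lemma invariant_iterate:
  assumes "invariant G" "z \<in> cball 0 R"
  shows "G ((f ^^ i) z) = G z"
  using assms iterate_maps[OF assms(2)] by (induction i) (auto simp: invariant_def)

lemma invariant_sum:
  assumes "continuous_on (cball 0 R) h"
  shows "invariant (\<lambda>z. \<Sum>i<p. h ((f ^^ i) z))"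
  unfolding invariant_def
proof (intro conjI ballI)
  show "continuous_on (cball 0 R) (\<lambda>z. \<Sum>i<p. h ((f ^^ i) z))"
    using iterate_maps by (intro continuous_intros continuous_on_compose2[OF assms] iterate_continuous) auto
next
  fix z :: complex assume z: "z \<in> cball 0 R"
  have "h z + (\<Sum>i<p. h ((f ^^ Suc i) z)) = (\<Sum>i<Suc p. h ((f ^^ i) z))"
    by (subst sum.lessThan_Suc_shift) simp
  also have "\<dots> = (\<Sum>i<p. h ((f ^^ i) z)) + h z"
    by (simp only: sum.lessThan_Suc periodic[OF z])
  finally show "(\<Sum>i<p. h ((f ^^ i) (f z))) = (\<Sum>i<p. h ((f ^^ i) z))"
    by (simp add: funpow_swap1)
qed

lemma invariant_prod:
  assumes "continuous_on (cball 0 R) h"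
  shows "invariant (\<lambda>z. \<Prod>i<p. h ((f ^^ i) z))"
  unfolding invariant_def
proof (intro conjI ballI)
  show "continuous_on (cball 0 R) (\<lambda>z. \<Prod>i<p. h ((f ^^ i) z))"
    using iterate_maps by (intro continuous_intros continuous_on_compose2[OF assms] iterate_continuous) auto
next
  fix z :: complex assume z: "z \<in> cball 0 R"
  obtain m where m: "p = Suc m"
    using p_pos gr0_conv_Suc by auto
  have "(\<Prod>i<p. h ((f ^^ i) (f z))) = (\<Prod>i<p. h ((f ^^ Suc i) z))"
    by (simp add: funpow_swap1)
  also have "\<dots> = (\<Prod>i<m. h ((f ^^ Suc i) z)) * h ((f ^^ p) z)"
    unfolding m by (rule prod.lessThan_Suc)
  also have "\<dots> = h z * (\<Prod>i<m. h ((f ^^ Suc i) z))"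
    by (simp only: periodic[OF z] mult.commute)
  also have "\<dots> = (\<Prod>i<p. h ((f ^^ i) z))"
    unfolding m prod.lessThan_Suc_shift by simp
  finally show "(\<Prod>i<p. h ((f ^^ i) (f z))) = (\<Prod>i<p. h ((f ^^ i) z))" .
qed

lemma displaced_disc_index_unique:
  assumes "displaced_disc c r" "i < p" "j < p"
    and "(f ^^ i) z \<in> cball c r" "(f ^^ j) z \<in> cball c r"
  shows "i = j"
proof -
  have "\<not> i < j" if "i < p" "j < p" "(f ^^ i) z \<in> cball c r" "(f ^^ j) z \<in> cball c r" for i j
  proof
    assume "i < j"
    then have "(f ^^ (j - i)) ((f ^^ i) z) = (f ^^ j) z"
      by (metis add_diff_inverse_nat comp_apply funpow_add add.commute less_imp_not_less)
    then show False
      using assms(1) that \<open>i < j\<close> unfolding displaced_disc_def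
      by (metis diff_le_self le_less_trans zero_less_diff)
  qed
  then show ?thesis
    using assms by (metis nat_neq_iff)
qed

text \<open>
  A function that is nonzero on the circle and close to \<open>G\<close> is blended into \<open>G\<close> by a cutoff that equals 1 on
  the circle and vanishes on its iterates and on the boundary. Summing the correction over the orbit makes
  it invariant without changing it on the circle.
\<close>
lemma invariant_perturbation:
  assumes G: "invariant G" and D: "displaced_disc c r" and "\<epsilon> > 0"
  shows "\<exists>G'. invariant G' \<and> (\<forall>z\<in>cball 0 R. norm (G' z - G z) < \<epsilon>) \<and>
    (\<forall>z\<in>sphere 0 R. G' z = G z) \<and> (\<forall>z\<in>sphere c r. G' z \<noteq> 0)"
proof -
  have contG: "continuous_on (cball 0 R) G"
    using G by (simp add: invariant_def)
  have sub: "cball c r \<subseteq> ball 0 R"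
    using D by (simp add: displaced_disc_def)
  obtain P where P: "continuous_on (cball 0 R) P" "\<And>z. z \<in> cball 0 R \<Longrightarrow> norm (P z - G z) < \<epsilon> / p"
      "\<And>z. z \<in> sphere c r \<Longrightarrow> P z \<noteq> 0"
    using nonvanishing_approximation_on_circle[OF compact_cball contG, of "\<epsilon> / p" c r] \<open>\<epsilon> > 0\<close> p_pos
    by auto
  \<comment> \<open>the set where the cutoff vanishes: the boundary and the iterates of the circle\<close>
  define T where "T = sphere 0 R \<union> (\<Union>i\<in>{1..<p}. cball 0 R \<inter> (f ^^ i) -` sphere c r)"
  have "closed T"
    unfolding T_def
    by (intro closed_Un closed_UN continuous_closed_preimage iterate_continuous ballI) auto
  moreover have "sphere c r \<inter> T = {}"
  proof -
    have "z \<notin> T" if z: "z \<in> sphere c r" for z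
    proof -
      have zc: "z \<in> cball c r"
        using z by simp
      have "z \<notin> sphere 0 R"
        using subsetD[OF sub zc] by simp
      moreover have "(f ^^ i) z \<notin> sphere c r" if "i \<in> {1..<p}" for i
      proof -
        have "(f ^^ i) z \<notin> cball c r"
          using D that zc by (simp add: displaced_disc_def)
        then show ?thesis
          by simp
      qed
      ultimately show ?thesis
        unfolding T_def by blast
    qed
    then show ?thesis
      by blast
  qed
  ultimately obtain u :: "complex \<Rightarrow> real" where u: "continuous_on UNIV u"
      "\<And>z. u z \<in> closed_segment 1 0" "\<And>z. z \<in> sphere c r \<Longrightarrow> u z = 1" "\<And>z. z \<in> T \<Longrightarrow> u z = 0"
    using Urysohn[of "sphere c r" T "1::real" 0] by (metis closed_sphere)
  have u01: "\<bar>u z\<bar> \<le> 1" for z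
    using u(2)[of z] by (auto simp: closed_segment_eq_real_ivl)
  define h where "h = (\<lambda>z. of_real (u z) * (P z - G z))"
  have conth: "continuous_on (cball 0 R) h"
    unfolding h_def by (intro continuous_intros P contG continuous_on_subset[OF u(1)]) auto
  have hsmall: "norm (h z) < \<epsilon> / p" if "z \<in> cball 0 R" for z
  proof -
    have "norm (h z) \<le> 1 * norm (P z - G z)"
      unfolding h_def norm_mult using u01[of z] by (intro mult_right_mono) auto
    then show ?thesis
      using P(2)[OF that] by simp
  qed
  define G' where "G' = (\<lambda>z. G z + (\<Sum>i<p. h ((f ^^ i) z)))"
  have "invariant G'"
    using G invariant_sum[OF conth] unfolding G'_def invariant_def
    by (auto intro!: continuous_intros)
  moreover have "norm (G' z - G z) < \<epsilon>" if z: "z \<in> cball 0 R" for z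
  proof -
    have "norm (G' z - G z) \<le> (\<Sum>i<p. norm (h ((f ^^ i) z)))"
      by (simp add: G'_def norm_sum)
    also have "\<dots> < (\<Sum>i<p. \<epsilon> / p)"
      using p_pos by (intro sum_strict_mono hsmall iterate_maps[OF z]) auto
    finally show ?thesis
      using p_pos by simp
  qed
  moreover have "G' z = G z" if z: "z \<in> sphere 0 R" for z
    using u(4)[of z] z by (simp add: G'_def iterate_boundary h_def T_def)
  moreover have "G' z \<noteq> 0" if z: "z \<in> sphere c r" for z
  proof -
    have zX: "z \<in> cball 0 R"
      using z sub by (auto simp: subset_iff)
    have "h ((f ^^ i) z) = 0" if i: "i \<in> {1..<p}" for i
    proof -
      have "(f ^^ (p - i)) ((f ^^ i) z) = (f ^^ p) z"
        using i by (metis comp_apply funpow_add atLeastLessThan_iff le_add_diff_inverse2 less_imp_le)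
      then have "(f ^^ (p - i)) ((f ^^ i) z) \<in> sphere c r"
        using periodic[OF zX] z by simp
      then have "(f ^^ i) z \<in> T"
        unfolding T_def using i iterate_maps[OF zX, of i]
        by (intro UnI2 UN_I[of "p - i"]) auto
      then show ?thesis
        using u(4) by (simp add: h_def)
    qed
    then have "(\<Sum>i<p. h ((f ^^ i) z)) = h z"
      using p_pos by (subst sum.remove[of _ 0]) (auto intro!: sum.neutral)
    then have "G' z = P z"
      using u(3)[OF z] by (simp add: G'_def h_def)
    then show ?thesis
      using P(3) z by simp
  qed
  ultimately show ?thesis
    by blast
qed

text \<open>
  On the circle, \<open>G = (z - c)\<^sup>n exp v\<close>. Dividing \<open>G\<close> by the \<open>n\<close>-th power of the invariant function
  \<open>H z = (\<Prod>i<p. f\<^sup>i z - c)\<close> cancels the winding of \<open>G\<close> around the disc and, simultaneously, around its iterates.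
  The quotient on the circle therefore has an extension \<open>M\<close> without zeros to the disc, which replaces the
  quotient there. On the boundary of the big disc \<open>H z = (z - c)\<^sup>p\<close>, so the price is a \<open>p\<close>-th power.
  The new function is invariant, and its only zeros are those that \<open>G\<close> has outside the disc and its iterates.
\<close>
lemma invariant_clear_disc:
  assumes G: "invariant G" and D: "displaced_disc c r" and nz: "\<And>z. z \<in> sphere c r \<Longrightarrow> G z \<noteq> 0"
  shows "\<exists>n G'. invariant G' \<and>
    (\<forall>z\<in>cball 0 R. G' z = 0 \<longrightarrow> G z = 0 \<and> (\<forall>i<p. (f ^^ i) z \<notin> cball c r)) \<and>
    (\<forall>z\<in>sphere 0 R. G z = G' z * ((z - c) powi n) ^ p)"
proof -
  have contG: "continuous_on (cball 0 R) G"
    using G by (simp add: invariant_def)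
  have sub: "cball c r \<subseteq> ball 0 R" and r: "0 < r"
    using D by (simp_all add: displaced_disc_def)
  have subX: "cball c r \<subseteq> cball 0 R"
    using sub by auto
  obtain n v where v: "continuous_on (sphere c r) v"
    and Gv: "\<And>z. z \<in> sphere c r \<Longrightarrow> G z = (z - c) powi n * exp (v z)"
    using nonvanishing_on_circle_eq_power_times_exp[OF r continuous_on_subset[OF contG] nz] subX by force
  obtain V where V: "continuous_on UNIV V" "\<And>z. z \<in> sphere c r \<Longrightarrow> V z = v z"
    using Dugundji[of UNIV UNIV "sphere c r" v] v by auto
  \<comment> \<open>The factor of \<open>H\<close> for \<open>i = 0\<close> is \<open>z - c\<close>; the others, collected in \<open>Q\<close>, have no zero in the disc.\<close>
  define Q where "Q = (\<lambda>w. \<Prod>i\<in>{1..<p}. (f ^^ i) w - c)"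
  define H where "H = (\<lambda>z. \<Prod>i<p. (f ^^ i) z - c)"
  define M where "M = (\<lambda>w. exp (V w) / Q w powi n)"
  have H: "invariant H"
    unfolding H_def by (rule invariant_prod) (intro continuous_intros)
  have HQ: "H w = (w - c) * Q w" for w
    using p_pos unfolding H_def Q_def by (subst prod.remove[of _ 0]) (auto intro!: prod.cong)
  have Qnz: "Q w \<noteq> 0" if "w \<in> cball c r" for w
  proof -
    have "(f ^^ i) w \<noteq> c" if "i \<in> {1..<p}" for i
      using D that \<open>w \<in> cball c r\<close> r unfolding displaced_disc_def
      by (metis atLeastLessThan_iff centre_in_cball less_eq_Suc_le less_imp_le One_nat_def)
    then show ?thesis
      by (auto simp: Q_def)
  qed
  have contM: "continuous_on (cball c r) M"
    unfolding M_def
  proof (intro continuous_intros continuous_on_subset[OF V(1)])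
    show "continuous_on (cball c r) Q"
      unfolding Q_def by (intro continuous_intros continuous_on_subset[OF iterate_continuous subX])
  qed (use Qnz in auto)
  define G' where "G' = (\<lambda>z. if \<exists>i<p. (f ^^ i) z \<in> cball c r
    then M ((f ^^ (THE i. i < p \<and> (f ^^ i) z \<in> cball c r)) z) else G z / H z powi n)"
  have G'_in: "G' z = M ((f ^^ i) z)" if "i < p" "(f ^^ i) z \<in> cball c r" for z i
  proof -
    have "(THE i. i < p \<and> (f ^^ i) z \<in> cball c r) = i"
      using that displaced_disc_index_unique[OF D] by (intro the_equality) auto
    then show ?thesis
      using that by (auto simp: G'_def)
  qed
  have G'_out: "G' z = G z / H z powi n" if z: "z \<in> cball 0 R" and "\<And>i. i < p \<Longrightarrow> (f ^^ i) z \<notin> ball c r" for z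
  proof (cases "\<exists>i<p. (f ^^ i) z \<in> cball c r")
    case True
    then obtain i where i: "i < p" "(f ^^ i) z \<in> cball c r"
      by blast
    define w where "w = (f ^^ i) z"
    have w: "w \<in> sphere c r"
      using i that(2)[of i] by (auto simp: w_def)
    have "G z / H z powi n = G w / H w powi n"
      using invariant_iterate[OF G z] invariant_iterate[OF H z] by (simp add: w_def)
    also have "\<dots> = M w"
      using w r by (auto simp: Gv HQ M_def V(2) power_int_mult_distrib)
    finally show ?thesis
      using G'_in[OF i] by (simp add: w_def)
  qed (auto simp: G'_def)
  \<comment> \<open>The two cases of the definition agree on the common boundary of finitely many closed pieces.\<close>
  have cont: "continuous_on (cball 0 R) G'"
  proof -
    define U where "U = (\<lambda>i. cball 0 R \<inter> (f ^^ i) -` cball c r)"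
    define W where "W = cball 0 R \<inter> (\<Inter>i\<in>{..<p}. cball 0 R \<inter> (f ^^ i) -` (- ball c r))"
    have "continuous_on (\<Union>i\<in>{..<p}. U i) G'"
    proof (rule continuous_on_closed_Union)
      fix i assume i: "i \<in> {..<p}"
      show "closed (U i)"
        unfolding U_def by (intro continuous_closed_preimage iterate_continuous) auto
      have "continuous_on (U i) (\<lambda>z. M ((f ^^ i) z))"
        by (intro continuous_on_compose2[OF contM] continuous_on_subset[OF iterate_continuous[of i]])
          (auto simp: U_def)
      then show "continuous_on (U i) G'"
        by (rule continuous_on_eq) (use i G'_in in \<open>auto simp: U_def\<close>)
    qed auto
    moreover have "closed (\<Union>i\<in>{..<p}. U i)"
      unfolding U_def by (intro closed_UN ballI continuous_closed_preimage iterate_continuous) auto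
    moreover have "closed W"
      unfolding W_def by (intro closed_Int closed_INT ballI continuous_closed_preimage iterate_continuous) auto
    moreover have "continuous_on W G'"
    proof -
      have W_out: "z \<in> cball 0 R" "\<And>i. i < p \<Longrightarrow> (f ^^ i) z \<notin> ball c r" if "z \<in> W" for z
        using that unfolding W_def by blast+
      have "H z \<noteq> 0" if "z \<in> W" for z
      proof -
        have "(f ^^ i) z \<noteq> c" if "i < p" for i
          using W_out(2)[OF \<open>z \<in> W\<close> that] r by (metis centre_in_ball)
        then show ?thesis
          by (auto simp: H_def)
      qed
      moreover have "continuous_on W H" "continuous_on W G"
        using contG H by (auto simp: invariant_def W_def intro: continuous_on_subset)
      ultimately have "continuous_on W (\<lambda>z. G z / H z powi n)"
        by (intro continuous_intros) auto
      then show ?thesis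
        by (rule continuous_on_eq) (rule G'_out[symmetric]; use W_out in blast)
    qed
    ultimately have "continuous_on ((\<Union>i\<in>{..<p}. U i) \<union> W) G'"
      by (intro continuous_on_closed_Un)
    moreover have "cball 0 R \<subseteq> (\<Union>i\<in>{..<p}. U i) \<union> W"
      by (auto simp: U_def W_def)
    ultimately show ?thesis
      using continuous_on_subset by blast
  qed
  have inv: "G' (f z) = G' z" if z: "z \<in> cball 0 R" for z
  proof (cases "\<exists>i<p. (f ^^ i) z \<in> cball c r")
    case True
    then obtain i where i: "i < p" "(f ^^ i) z \<in> cball c r"
      by blast
    define j where "j = (if i = 0 then p - 1 else i - 1)"
    have "(f ^^ j) (f z) = (f ^^ Suc j) z"
      by (simp add: funpow_swap1)
    also have "\<dots> = (f ^^ i) z"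
      using periodic[OF z] p_pos by (simp add: j_def del: funpow.simps)
    finally have j: "(f ^^ j) (f z) = (f ^^ i) z" .
    have "j < p"
      using i p_pos by (auto simp: j_def)
    then show ?thesis
      using G'_in[of j "f z"] G'_in[of i z] i j by simp
  next
    case False
    have "(f ^^ i) (f z) \<notin> cball c r" if "i < p" for i
    proof (cases "Suc i < p")
      case True
      then show ?thesis
        using False by (metis comp_apply funpow_Suc_right)
    next
      case 2: False
      then have "Suc i = p"
        using that by simp
      then have "(f ^^ i) (f z) = z"
        using periodic[OF z] by (metis comp_apply funpow_Suc_right)
      then show ?thesis
        using False p_pos by (metis funpow_0)
    qed
    moreover have "f z \<in> cball 0 R"
      using iterate_maps[OF z, of 1] by simp
    ultimately have "G' (f z) = G (f z) / H (f z) powi n" "G' z = G z / H z powi n"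
      using z False ball_subset_cball[of c r] by (blast intro: G'_out)+
    then show ?thesis
      using G H z by (simp add: invariant_def)
  qed
  have zeros: "G z = 0 \<and> (\<forall>i<p. (f ^^ i) z \<notin> cball c r)" if z: "z \<in> cball 0 R" and "G' z = 0" for z
  proof -
    have out: "(f ^^ i) z \<notin> cball c r" if "i < p" for i
    proof
      assume "(f ^^ i) z \<in> cball c r"
      then show False
        using G'_in[OF that] Qnz \<open>G' z = 0\<close> by (auto simp: M_def)
    qed
    have "(f ^^ i) z \<noteq> c" if "i < p" for i
      using out[OF that] r by (metis centre_in_cball less_imp_le)
    then have "H z \<noteq> 0"
      by (auto simp: H_def)
    moreover have "G' z = G z / H z powi n"
      using out ball_subset_cball[of c r] by (blast intro: G'_out[OF z])
    ultimately show ?thesis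
      using out \<open>G' z = 0\<close> by auto
  qed
  have "G z = G' z * ((z - c) powi n) ^ p" if z: "z \<in> sphere 0 R" for z
  proof -
    have "z \<notin> cball c r"
      using sub z by auto
    moreover from this have "z \<noteq> c"
      using r by auto
    moreover have "H z = (z - c) ^ p"
      by (simp add: H_def iterate_boundary[OF z])
    ultimately show ?thesis
      using z G'_out[of z] by (simp add: iterate_boundary power_int_power power_int_power' mult.commute)
  qed
  then show ?thesis
    using cont inv zeros unfolding invariant_def by blast
qed

section \<open>Rigidity of periodic disc maps\<close>

text \<open>
  Clearing the discs one at a time changes \<open>G\<close> on the boundary only by \<open>p\<close>-th powers, until a function
  without zeros remains, whose logarithm on the disc can be divided by \<open>p\<close>. The zeros must lie in the orbits
  of the \<^emph>\<open>open\<close> discs, because then a small perturbation, needed to free the next circle from zeros, keeps them there.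
\<close>
lemma invariant_has_root_on_boundary:
  assumes "finite J"
    and "\<And>c r. (c, r) \<in> J \<Longrightarrow> displaced_disc c r"
    and "invariant G" "\<And>z. z \<in> sphere 0 R \<Longrightarrow> G z \<noteq> 0"
    and "\<And>z. z \<in> cball 0 R \<Longrightarrow> G z = 0 \<Longrightarrow> \<exists>(c, r)\<in>J. \<exists>i<p. (f ^^ i) z \<in> ball c r"
  shows "\<exists>q. continuous_on (sphere 0 R) q \<and> (\<forall>z\<in>sphere 0 R. q z ^ p = G z)"
  using assms
proof (induction J arbitrary: G rule: finite_induct)
  case empty
  have "continuous_on (cball 0 R) G"
    using empty by (simp add: invariant_def)
  then obtain L where L: "continuous_on (cball 0 R) L" "\<And>z. z \<in> cball 0 R \<Longrightarrow> G z = exp (L z)"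
    using continuous_logarithm_on_cball[of 0 R G] empty(4) by auto
  have "continuous_on (sphere 0 R) (\<lambda>z. exp (L z / of_nat p))"
    using p_pos by (intro continuous_intros continuous_on_subset[OF L(1)]) auto
  moreover have "exp (L z / of_nat p) ^ p = G z" if "z \<in> sphere 0 R" for z
    using L(2)[of z] that p_pos by (simp flip: exp_of_nat_mult)
  ultimately show ?case
    by blast
next
  case (insert cr J)
  obtain c r where cr: "cr = (c, r)"
    by fastforce
  have D: "displaced_disc c r"
    using insert.prems(1) cr by simp
  have sub: "cball c r \<subseteq> ball 0 R"
    using D by (simp add: displaced_disc_def)
  \<comment> \<open>On the compact set \<open>Z\<close> of points whose orbits miss all the discs, \<open>G\<close> is bounded away from 0, which
    tells how small the perturbation has to be.\<close>
  define Z where "Z = cball 0 R \<inter> (\<Inter>(c, r)\<in>insert cr J. \<Inter>i\<in>{..<p}. cball 0 R \<inter> (f ^^ i) -` (- ball c r))"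
  have closed_out: "closed (cball 0 R \<inter> (f ^^ i) -` (- ball c r))" for i c r
    by (intro continuous_closed_preimage iterate_continuous) auto
  have "closed Z"
    unfolding Z_def split_beta
    by (rule closed_Int[OF closed_cball], intro closed_INT ballI, rule closed_out)
  moreover have "bounded Z"
    by (rule bounded_subset[OF bounded_cball[of 0 R]]) (unfold Z_def, rule Int_lower1)
  ultimately have "compact Z"
    by (simp add: compact_eq_bounded_closed)
  have Z: "\<exists>(c, r)\<in>insert cr J. \<exists>i<p. (f ^^ i) z \<in> ball c r" if "z \<in> cball 0 R" "z \<notin> Z" for z
    using that iterate_maps[OF that(1)] unfolding Z_def by fast
  have Znz: "G z \<noteq> 0" if "z \<in> Z" for z
  proof
    assume "G z = 0"
    moreover have "z \<in> cball 0 R"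
      using that by (simp add: Z_def)
    ultimately show False
      using insert.prems(4)[of z] that unfolding Z_def by blast
  qed
  have "continuous_on Z (\<lambda>z. norm (G z))"
    using insert.prems(2) unfolding invariant_def Z_def
    by (intro continuous_intros) (auto intro: continuous_on_subset)
  then obtain \<epsilon> where \<epsilon>: "\<epsilon> > 0" "\<And>z. z \<in> Z \<Longrightarrow> \<epsilon> \<le> norm (G z)"
  proof (cases "Z = {}")
    case False
    then obtain z0 where "z0 \<in> Z" "\<And>z. z \<in> Z \<Longrightarrow> norm (G z0) \<le> norm (G z)"
      using continuous_attains_inf[OF \<open>compact Z\<close> _ \<open>continuous_on Z (\<lambda>z. norm (G z))\<close>] by blast
    then show ?thesis
      using that[of "norm (G z0)"] Znz by auto
  qed (use that[of 1] in auto)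
  obtain G' where G': "invariant G'" "\<And>z. z \<in> cball 0 R \<Longrightarrow> norm (G' z - G z) < \<epsilon>"
      "\<And>z. z \<in> sphere 0 R \<Longrightarrow> G' z = G z" "\<And>z. z \<in> sphere c r \<Longrightarrow> G' z \<noteq> 0"
    using invariant_perturbation[OF insert.prems(2) D \<epsilon>(1)] by blast
  obtain n G'' where G'': "invariant G''"
      "\<And>z. z \<in> cball 0 R \<Longrightarrow> G'' z = 0 \<Longrightarrow> G' z = 0"
      "\<And>z i. z \<in> cball 0 R \<Longrightarrow> G'' z = 0 \<Longrightarrow> i < p \<Longrightarrow> (f ^^ i) z \<notin> cball c r"
      "\<And>z. z \<in> sphere 0 R \<Longrightarrow> G' z = G'' z * ((z - c) powi n) ^ p"
    using invariant_clear_disc[OF G'(1) D G'(4)] by blast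
  have "\<exists>q. continuous_on (sphere 0 R) q \<and> (\<forall>z\<in>sphere 0 R. q z ^ p = G'' z)"
  proof (rule insert.IH)
    show "displaced_disc c r" if "(c, r) \<in> J" for c r
      using insert.prems(1) that by simp
    show "invariant G''"
      by fact
    show "G'' z \<noteq> 0" if "z \<in> sphere 0 R" for z
      using G''(4)[OF that] G'(3)[OF that] insert.prems(3)[OF that] by auto
    show "\<exists>(c, r)\<in>J. \<exists>i<p. (f ^^ i) z \<in> ball c r" if z: "z \<in> cball 0 R" and 0: "G'' z = 0" for z
    proof -
      have "z \<notin> Z"
        using G''(2)[OF z 0] G'(2)[OF z] \<epsilon>(2)[of z] by auto
      then obtain c' r' i where *: "(c', r') \<in> insert cr J" "i < p" "(f ^^ i) z \<in> ball c' r'"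
        using Z[OF z] by blast
      moreover have "(f ^^ i) z \<notin> ball c r"
        using G''(3)[OF z 0 \<open>i < p\<close>] by auto
      ultimately have "(c', r') \<in> J"
        using cr by auto
      with * show ?thesis
        by blast
    qed
  qed
  then obtain q where q: "continuous_on (sphere 0 R) q" "\<And>z. z \<in> sphere 0 R \<Longrightarrow> q z ^ p = G'' z"
    by blast
  have "c \<in> ball 0 R"
    using D subsetD[OF sub, of c] by (simp add: displaced_disc_def)
  then have "z - c \<noteq> 0" if "z \<in> sphere 0 R" for z
    using that by auto
  then have "continuous_on (sphere 0 R) (\<lambda>z. q z * (z - c) powi n)"
    by (intro continuous_intros q) auto
  moreover have "(q z * (z - c) powi n) ^ p = G z" if "z \<in> sphere 0 R" for z
    using q(2)[OF that] G''(4)[OF that] G'(3)[OF that] by (simp add: power_mult_distrib)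
  ultimately show ?case
    by blast
qed

text \<open>
  By continuity, small discs around a point that the iterates move are displaced as well.
\<close>
lemma displaced_disc_exists:
  assumes z: "z \<in> ball 0 R" and free: "\<And>i. 0 < i \<Longrightarrow> i < p \<Longrightarrow> (f ^^ i) z \<noteq> z"
  shows "\<exists>r. displaced_disc z r"
proof -
  have zX: "z \<in> cball 0 R"
    using z by auto
  have 1: "eventually (\<lambda>r. r > 0) (at_right (0::real))"
    by (simp add: eventually_at_right_less)
  obtain e where e: "e > 0" "cball z e \<subseteq> ball 0 R"
    using z open_contains_cball by blast
  have below: "eventually (\<lambda>r. r < d) (at_right (0::real))" if "d > 0" for d
    using that by (auto simp: eventually_at_right_field)
  have 2: "eventually (\<lambda>r. cball z r \<subseteq> ball 0 R) (at_right 0)"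
    using below[OF e(1)] by eventually_elim (use e(2) in auto)
  have "eventually (\<lambda>r. \<forall>w\<in>cball z r \<inter> cball 0 R. (f ^^ i) w \<notin> cball z r) (at_right 0)"
    if i: "i \<in> {1..<p}" for i
  proof -
    define d where "d = dist z ((f ^^ i) z)"
    have d: "d > 0"
      using free[of i] i by (auto simp: d_def)
    then obtain \<delta> where \<delta>: "\<delta> > 0"
        "\<And>w. w \<in> cball 0 R \<Longrightarrow> dist w z < \<delta> \<Longrightarrow> dist ((f ^^ i) w) ((f ^^ i) z) < d / 2"
      using iterate_continuous[of i] zX unfolding continuous_on_iff by (metis half_gt_zero)
    show ?thesis
      using below[OF \<delta>(1)] below[OF half_gt_zero[OF d]]
    proof eventually_elim
      case (elim r)
      have "(f ^^ i) w \<notin> cball z r" if w: "w \<in> cball z r" "w \<in> cball 0 R" for w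
      proof
        assume "(f ^^ i) w \<in> cball z r"
        moreover have "dist ((f ^^ i) w) ((f ^^ i) z) < d / 2"
          using \<delta>(2)[OF w(2)] w(1) elim by (simp add: dist_commute)
        ultimately show False
          using elim d dist_triangle[of z "(f ^^ i) z" "(f ^^ i) w"] by (simp add: d_def)
      qed
      then show ?case
        by blast
    qed
  qed
  then have 3: "eventually (\<lambda>r. \<forall>i\<in>{1..<p}. \<forall>w\<in>cball z r \<inter> cball 0 R. (f ^^ i) w \<notin> cball z r) (at_right 0)"
    by (intro eventually_ball_finite) auto
  have "eventually (\<lambda>r. displaced_disc z r) (at_right 0)"
    using 1 2 3
  proof eventually_elim
    case (elim r)
    have "(f ^^ i) w \<notin> cball z r" if "0 < i" "i < p" "w \<in> cball z r" for i w
    proof -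
      have "w \<in> cball 0 R"
        using elim(2) that(3) by auto
      then show ?thesis
        using elim(3) that by auto
    qed
    then show ?case
      using elim(1,2) unfolding displaced_disc_def by blast
  qed
  then show ?thesis
    using eventually_happens' trivial_limit_at_right_real by blast
qed

text \<open>
  A point moved by \<open>f\<close> is moved by all \<open>f\<^sup>i\<close> with \<open>0 < i < p\<close>, because \<open>i\<close> is invertible modulo the
  prime \<open>p\<close>. Therefore every zero of the averaged function \<open>G\<close> is the centre of a displaced disc.
\<close>
lemma prime_period_fixes_all:
  assumes p: "prime p" and y: "y \<in> cball 0 R"
  shows "f y = y"
proof (rule ccontr)
  assume fy: "f y \<noteq> y"
  have yR: "norm y < R"
    using y boundary[of y] fy by (cases "norm y = R") auto
  have iterate_fix: "(f ^^ i) z = z" if "f z = z" for z i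
    using that by (induction i) auto
  have free: "f z = z" if z: "z \<in> cball 0 R" and i: "0 < i" "i < p" "(f ^^ i) z = z" for z i
  proof -
    have "coprime i p"
      using p i by (metis coprime_commute prime_imp_coprime nat_dvd_not_less)
    then obtain a b where ab: "i * a = p * b + 1"
      using bezout_nat[of i p] i by auto
    have fixed_mult: "(f ^^ (k * m)) z = z" if "(f ^^ k) z = z" for k m
    proof (induction m)
      case (Suc m)
      then show ?case
        using that by (simp add: funpow_add)
    qed simp
    have "z = (f ^^ (p * b + 1)) z"
      using fixed_mult[OF i(3), of a] by (simp add: ab)
    also have "\<dots> = f ((f ^^ (p * b)) z)"
      by simp
    also have "\<dots> = f z"
      using fixed_mult[OF periodic[OF z]] by simp
    finally show ?thesis
      by simp
  qed
  define G where "G = (\<lambda>z. (\<Sum>i<p. (f ^^ i) z) / of_nat p - y)"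
  have "invariant (\<lambda>z. \<Sum>i<p. (f ^^ i) z)"
    using invariant_sum[of "\<lambda>z. z"] by simp
  then have G: "invariant G"
    using p_pos unfolding invariant_def G_def by (auto intro!: continuous_intros)
  have G_fixed: "G z = z - y" if "f z = z" for z
    using p_pos by (simp add: G_def iterate_fix[OF that])
  have G_boundary: "G z = z - y" if "z \<in> sphere 0 R" for z
    using G_fixed[OF boundary[OF that]] .
  have moved: "f z \<noteq> z" if "G z = 0" for z
    using that G_fixed fy by force
  define K where "K = cball 0 R \<inter> G -` {0}"
  have "closed K"
    using G unfolding K_def invariant_def by (intro continuous_closed_preimage) auto
  moreover have "bounded K"
    by (rule bounded_subset[OF bounded_cball[of 0 R]]) (unfold K_def, rule Int_lower1)
  ultimately have "compact K"
    by (simp add: compact_eq_bounded_closed)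
  have "\<exists>r. displaced_disc z r" if "z \<in> K" for z
  proof (rule displaced_disc_exists)
    have zX: "z \<in> cball 0 R" and "G z = 0"
      using that by (auto simp: K_def)
    then show "z \<in> ball 0 R"
      using boundary[of z] moved[of z] by (cases "norm z = R") auto
    show "(f ^^ i) z \<noteq> z" if "0 < i" "i < p" for i
      using free[OF zX that] moved[OF \<open>G z = 0\<close>] by blast
  qed
  then obtain \<rho> where \<rho>: "\<And>z. z \<in> K \<Longrightarrow> displaced_disc z (\<rho> z)"
    by metis
  have "K \<subseteq> (\<Union>z\<in>K. ball z (\<rho> z))"
    using \<rho> by (auto simp: displaced_disc_def)
  then obtain K' where K': "K' \<subseteq> K" "finite K'" "K \<subseteq> (\<Union>z\<in>K'. ball z (\<rho> z))"
    using compactE_image[OF \<open>compact K\<close>, of K "\<lambda>z. ball z (\<rho> z)"] by auto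
  have "\<exists>q. continuous_on (sphere 0 R) q \<and> (\<forall>z\<in>sphere 0 R. q z ^ p = G z)"
  proof (rule invariant_has_root_on_boundary[of "(\<lambda>z. (z, \<rho> z)) ` K'"])
    show "finite ((\<lambda>z. (z, \<rho> z)) ` K')"
      using K' by simp
    show "displaced_disc c r" if "(c, r) \<in> (\<lambda>z. (z, \<rho> z)) ` K'" for c r
      using that \<rho> K'(1) by auto
    show "invariant G"
      by fact
    show "G z \<noteq> 0" if "z \<in> sphere 0 R" for z
      using G_boundary[OF that] that yR by auto
    show "\<exists>(c, r)\<in>(\<lambda>z. (z, \<rho> z)) ` K'. \<exists>i<p. (f ^^ i) z \<in> ball c r"
      if "z \<in> cball 0 R" "G z = 0" for z
    proof -
      have "z \<in> K"
        using that by (simp add: K_def)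
      then obtain w where "w \<in> K'" "z \<in> ball w (\<rho> w)"
        using K'(3) by blast
      then show ?thesis
        using p_pos by (auto intro!: bexI[of _ w] exI[of _ 0])
    qed
  qed
  then obtain q where "continuous_on (sphere 0 R) q" "\<And>z. z \<in> sphere 0 R \<Longrightarrow> q z ^ p = z - y"
    using G_boundary by auto
  then show False
    using no_root_of_linear_on_circle[OF yR prime_gt_1_nat[OF p]] by blast
qed

text \<open>
  If the exact period were greater than 1, a suitable power of \<open>f\<close> would have exact prime period.
\<close>
theorem fixes_all:
  assumes y: "y \<in> cball 0 R"
  shows "f y = y"
proof -
  define P where "P = (\<lambda>n. n > 0 \<and> (\<forall>z\<in>cball 0 R. (f ^^ n) z = z))"
  define n where "n = (LEAST n. P n)"
  have "P p"
    using p_pos periodic by (simp add: P_def)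
  then have n: "P n"
    unfolding n_def by (rule LeastI)
  show ?thesis
  proof (cases "n = 1")
    case True
    then show ?thesis
      using n y by (simp add: P_def)
  next
    case False
    then obtain q where q: "prime q" "q dvd n"
      using prime_factor_nat by blast
    then obtain m where m: "n = m * q"
      by (metis dvd_div_mult_self)
    interpret power: periodic_disc_map "f ^^ m" R q
    proof
      show "q > 0"
        using q prime_gt_0_nat by blast
      show "continuous_on (cball 0 R) (f ^^ m)"
        by (rule iterate_continuous)
      show "(f ^^ m) ` cball 0 R \<subseteq> cball 0 R"
        using iterate_maps by blast
      show "((f ^^ m) ^^ q) z = z" if "z \<in> cball 0 R" for z
        using n that m by (simp add: P_def funpow_mult mult.commute)
      show "(f ^^ m) z = z" if "z \<in> sphere 0 R" for z
        by (rule iterate_boundary[OF that])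
    qed
    have "P m"
      using n m power.prime_period_fixes_all[OF q(1)] by (auto simp: P_def)
    then have "n \<le> m"
      unfolding n_def by (rule Least_le)
    moreover have "m > 0" "q > 1"
      using n m q prime_gt_1_nat by (auto simp: P_def)
    ultimately have False
      using m by auto
    then show ?thesis ..
  qed
qed

end

section \<open>Torsion groups with a commutative subgroup of finite index\<close>

context group
begin

lemma finite_powers_of_torsion:
  assumes "x \<in> carrier G" "n > 0" "x [^] (n::nat) = \<one>"
  shows "finite (range (\<lambda>k::nat. x [^] k))"
proof -
  have "x [^] k = x [^] (k mod n)" for k :: nat
  proof -
    have "x [^] k = x [^] (n * (k div n) + k mod n)"
      by simp
    also have "\<dots> = (x [^] n) [^] (k div n) \<otimes> x [^] (k mod n)"
      using assms(1) by (simp only: nat_pow_mult[symmetric] nat_pow_pow[symmetric])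
    finally show ?thesis
      using assms by simp
  qed
  then have "range (\<lambda>k::nat. x [^] k) \<subseteq> (\<lambda>k. x [^] k) ` {..<n}"
    using assms(2) by (metis image_subsetI imageI lessThan_iff mod_less_divisor)
  then show ?thesis
    using finite_surj by blast
qed

text \<open>
  The products of powers of the elements of \<open>Y\<close> form such a set.
\<close>
lemma commuting_torsion_finite_absorbing_set:
  assumes "finite Y" "Y \<subseteq> carrier G"
    and "\<And>x y. x \<in> Y \<Longrightarrow> y \<in> Y \<Longrightarrow> x \<otimes> y = y \<otimes> x"
    and "\<And>x. x \<in> Y \<Longrightarrow> \<exists>n::nat. n > 0 \<and> x [^] n = \<one>"
  shows "\<exists>A. finite A \<and> A \<subseteq> carrier G \<and> \<one> \<in> A \<and> (\<forall>y\<in>Y. \<forall>a\<in>A. y \<otimes> a \<in> A)"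
  using assms
proof (induction Y)
  case empty
  then show ?case
    by (intro exI[of _ "{\<one>}"]) auto
next
  case (insert y Y)
  have "\<exists>A. finite A \<and> A \<subseteq> carrier G \<and> \<one> \<in> A \<and> (\<forall>y\<in>Y. \<forall>a\<in>A. y \<otimes> a \<in> A)"
    by (rule insert.IH) (use insert.prems in simp_all)
  then obtain A where A: "finite A" "A \<subseteq> carrier G" "\<one> \<in> A" "\<And>y a. y \<in> Y \<Longrightarrow> a \<in> A \<Longrightarrow> y \<otimes> a \<in> A"
    by blast
  have y: "y \<in> carrier G"
    using insert.prems by auto
  obtain n :: nat where n: "n > 0" "y [^] n = \<one>"
    using insert.prems(3) by auto
  define B where "B = (\<lambda>(x, a). x \<otimes> a) ` (range (\<lambda>k::nat. y [^] k) \<times> A)"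
  have BI: "y [^] k \<otimes> a \<in> B" if "a \<in> A" for k :: nat and a
    using that unfolding B_def by force
  have BE: "\<exists>k::nat. \<exists>a\<in>A. b = y [^] k \<otimes> a" if "b \<in> B" for b
    using that unfolding B_def by auto
  have "finite B"
    unfolding B_def using A(1) finite_powers_of_torsion[OF y n] by auto
  moreover have "B \<subseteq> carrier G"
    using BE A(2) y by blast
  moreover have "\<one> \<in> B"
    using BI[OF A(3), of 0] by simp
  moreover have "y' \<otimes> b \<in> B" if y': "y' \<in> insert y Y" and b: "b \<in> B" for y' b
  proof -
    obtain k :: nat and a where ka: "a \<in> A" "b = y [^] k \<otimes> a"
      using BE[OF b] by blast
    have a: "a \<in> carrier G" and y'c: "y' \<in> carrier G"
      using ka A(2) y' insert.prems(1) by auto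
    show ?thesis
    proof (cases "y' = y")
      case True
      then have "y' \<otimes> b = y [^] (Suc k) \<otimes> a"
        using y a by (simp add: ka m_assoc[symmetric] nat_pow_Suc2[symmetric] del: nat_pow_Suc)
      then show ?thesis
        using BI[OF ka(1), of "Suc k"] by simp
    next
      case False
      then have "y' \<in> Y"
        using y' by simp
      have comm: "y' \<otimes> y = y \<otimes> y'"
        using insert.prems(2) y' by simp
      have "y' \<otimes> y [^] k = y [^] k \<otimes> y'"
      proof (induction k)
        case (Suc k)
        have "y' \<otimes> y [^] Suc k = (y' \<otimes> y [^] k) \<otimes> y"
          using y y'c by (simp add: m_assoc)
        also have "\<dots> = y [^] k \<otimes> (y' \<otimes> y)"
          using y y'c by (simp add: Suc m_assoc)
        also have "\<dots> = y [^] Suc k \<otimes> y'"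
          using y y'c by (simp add: comm m_assoc)
        finally show ?case .
      qed (use y'c in simp)
      then have "y' \<otimes> b = y [^] k \<otimes> (y' \<otimes> a)"
        using y y'c a by (simp add: ka m_assoc[symmetric])
      then show ?thesis
        using BI A(4)[OF \<open>y' \<in> Y\<close> ka(1)] by simp
    qed
  qed
  ultimately show ?case
    by blast
qed

text \<open>
  For a subgroup \<open>H\<close>, the hypothesis on \<open>\<tau>\<close> says that \<open>\<tau>\<close> separates the left cosets of \<open>H\<close>. As in Schreier's lemma,
  choose for each value of \<open>\<tau>\<close> a representative \<open>t\<close>; for a generator \<open>s\<close> the product \<open>s t\<close> equals \<open>t' y\<close> with another representative \<open>t'\<close>
  and one of finitely many elements \<open>y\<close> of \<open>H\<close>. If \<open>A\<close> is a finite set that absorbs these \<open>y\<close>, then the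
  finite set \<open>T A\<close> is stable under left multiplication by generators and contains \<open>\<one>\<close>, so it is the whole group.
\<close>
lemma finite_if_virtually_commuting_torsion:
  assumes X: "finite X" "X \<subseteq> carrier G" "generate G X = carrier G"
    and torsion: "\<And>x. x \<in> carrier G \<Longrightarrow> \<exists>n::nat. n > 0 \<and> x [^] n = \<one>"
    and \<tau>: "finite (\<tau> ` carrier G)"
    and H: "\<And>g h. g \<in> carrier G \<Longrightarrow> h \<in> carrier G \<Longrightarrow> \<tau> g = \<tau> h \<Longrightarrow> inv g \<otimes> h \<in> H"
    and comm: "\<And>x y. x \<in> H \<Longrightarrow> y \<in> H \<Longrightarrow> x \<otimes> y = y \<otimes> x"
  shows "finite (carrier G)"
proof -
  obtain \<rho> where \<rho>: "\<And>g. g \<in> carrier G \<Longrightarrow> \<rho> (\<tau> g) \<in> carrier G \<and> \<tau> (\<rho> (\<tau> g)) = \<tau> g"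
  proof
    show "inv_into (carrier G) \<tau> (\<tau> g) \<in> carrier G \<and> \<tau> (inv_into (carrier G) \<tau> (\<tau> g)) = \<tau> g"
      if "g \<in> carrier G" for g
      using that by (auto intro: inv_into_into f_inv_into_f)
  qed
  define T where "T = \<rho> ` \<tau> ` carrier G"
  define S where "S = X \<union> m_inv G ` X"
  define c where "c = (\<lambda>g. inv (\<rho> (\<tau> g)) \<otimes> g)"
  \<comment> \<open>The element for \<open>\<one>\<close> is included to have \<open>\<one>\<close> in \<open>T A\<close>: the representative of its class
    need not be \<open>\<one>\<close>.\<close>
  define Y where "Y = c ` insert \<one> ((\<lambda>(s, t). s \<otimes> t) ` (S \<times> T))"
  have T: "finite T" "T \<subseteq> carrier G"
    using \<tau> \<rho> by (auto simp: T_def)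
  have S: "finite S" "S \<subseteq> carrier G"
    using X by (auto simp: S_def)
  have c: "c g \<in> carrier G" "c g \<in> H" "\<rho> (\<tau> g) \<otimes> c g = g" "\<rho> (\<tau> g) \<in> T" if "g \<in> carrier G" for g
  proof -
    show "c g \<in> carrier G" "\<rho> (\<tau> g) \<in> T"
      using that \<rho> by (auto simp: c_def T_def)
    show "c g \<in> H"
      unfolding c_def using H[of "\<rho> (\<tau> g)" g] \<rho> that by auto
    show "\<rho> (\<tau> g) \<otimes> c g = g"
      using \<rho> that by (auto simp: c_def m_assoc[symmetric])
  qed
  have prodST: "(\<lambda>(s, t). s \<otimes> t) ` (S \<times> T) \<subseteq> carrier G"
    using S(2) T(2) by auto
  have YH: "x \<in> carrier G \<and> x \<in> H" if "x \<in> Y" for x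
    using that prodST c(1,2) unfolding Y_def by blast
  have "finite Y"
    unfolding Y_def using S(1) T(1) by simp
  then have "\<exists>A. finite A \<and> A \<subseteq> carrier G \<and> \<one> \<in> A \<and> (\<forall>y\<in>Y. \<forall>a\<in>A. y \<otimes> a \<in> A)"
  proof (rule commuting_torsion_finite_absorbing_set)
    show "x \<otimes> y = y \<otimes> x" if "x \<in> Y" "y \<in> Y" for x y
      using comm YH that by simp
  qed (use YH torsion in auto)
  then obtain A where A: "finite A" "A \<subseteq> carrier G" "\<one> \<in> A" "\<And>y a. y \<in> Y \<Longrightarrow> a \<in> A \<Longrightarrow> y \<otimes> a \<in> A"
    by blast
  define B where "B = (\<lambda>(t, a). t \<otimes> a) ` (T \<times> A)"
  have "finite B"
    unfolding B_def using A(1) T(1) by simp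
  have BI: "t \<otimes> a \<in> B" if "t \<in> T" "a \<in> A" for t a
    using that unfolding B_def by force
  have Bc: "B \<subseteq> carrier G"
    unfolding B_def using A(2) T(2) by auto
  have "\<one> \<in> B"
  proof -
    have "c \<one> \<in> Y"
      by (simp add: Y_def)
    then have "c \<one> \<otimes> \<one> \<in> A"
      using A(3,4) by blast
    then have "c \<one> \<in> A"
      using c(1)[of \<one>] by simp
    then show ?thesis
      using BI c(3,4)[of \<one>] by (metis one_closed)
  qed
  have SB: "s \<otimes> b \<in> B" if s: "s \<in> S" and b: "b \<in> B" for s b
  proof -
    obtain t a where ta: "t \<in> T" "a \<in> A" "b = t \<otimes> a"
      using b unfolding B_def by auto
    have car: "s \<in> carrier G" "t \<in> carrier G" "a \<in> carrier G" "s \<otimes> t \<in> carrier G"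
      using s ta S T A by auto
    have "c (s \<otimes> t) \<in> Y"
      unfolding Y_def using s ta by force
    then have "c (s \<otimes> t) \<otimes> a \<in> A"
      using A(4) ta by simp
    moreover have "s \<otimes> b = \<rho> (\<tau> (s \<otimes> t)) \<otimes> (c (s \<otimes> t) \<otimes> a)"
      using car c[OF car(4)] \<rho>[OF car(4)] by (simp add: ta m_assoc[symmetric])
    ultimately show ?thesis
      using BI c(4)[OF car(4)] by simp
  qed
  have "g \<otimes> b \<in> B" if "g \<in> generate G X" "b \<in> B" for g b
    using that
  proof (induction arbitrary: b rule: generate.induct)
    case one
    then show ?case
      using Bc by auto
  next
    case (incl h)
    then show ?case
      using SB by (simp add: S_def)
  next
    case (inv h)
    then show ?case
      using SB by (simp add: S_def)
  next
    case (eng h1 h2)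
    have "h1 \<in> carrier G" "h2 \<in> carrier G"
      using eng(1,2) X by auto
    then show ?case
      using eng Bc by (auto simp: m_assoc)
  qed
  then have "g \<in> B" if "g \<in> carrier G" for g
    using that X(3) \<open>\<one> \<in> B\<close> by (metis r_one)
  then show ?thesis
    by (intro finite_subset[OF _ \<open>finite B\<close>] subsetI)
qed

end

section \<open>Periodic homeomorphisms of the annulus\<close>

text \<open>
  The annulus is identified with \<open>{z. 1 \<le> norm z \<le> 2}\<close>; its level \<open>t\<close> becomes the circle of radius \<open>1 + t\<close>.
\<close>
definition annulus_embedding :: "complex \<times> real \<Rightarrow> complex"
  where "annulus_embedding x = of_real (1 + snd x) * fst x"

text \<open>
  On the punctured disc of radius 2 this is radial projection to \<open>{z. 1 \<le> norm z \<le> 2}\<close>, read in the annulus.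
\<close>
definition annulus_retraction :: "complex \<Rightarrow> complex \<times> real"
  where "annulus_retraction z = (sgn z, max (norm z) 1 - 1)"

lemma norm_annulus_embedding: "x \<in> closed_annulus \<Longrightarrow> norm (annulus_embedding x) = 1 + snd x"
  unfolding annulus_embedding_def norm_mult norm_of_real by (auto simp: closed_annulus_def)

lemma annulus_retraction_embedding:
  assumes x: "x \<in> closed_annulus"
  shows "annulus_retraction (annulus_embedding x) = x"
proof -
  have "sgn (annulus_embedding x) = of_real (sgn (1 + snd x)) * sgn (fst x)"
    by (simp only: annulus_embedding_def sgn_mult sgn_of_real)
  moreover have "sgn (1 + snd x) = 1" "sgn (fst x) = fst x"
    using x by (auto simp: closed_annulus_def sgn_div_norm)
  ultimately have "sgn (annulus_embedding x) = fst x"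
    by simp
  then show ?thesis
    using x norm_annulus_embedding[OF x] by (auto simp: annulus_retraction_def closed_annulus_def)
qed

lemma annulus_embedding_retraction:
  "of_real (min (norm z) 1) * annulus_embedding (annulus_retraction z) = z"
proof (cases "z = 0")
  case False
  have "min (norm z) 1 * (1 + (max (norm z) 1 - 1)) = norm z"
    by (auto simp: min_def max_def)
  then have "of_real (min (norm z) 1) * annulus_embedding (annulus_retraction z) = of_real (norm z) * sgn z"
    by (simp only: annulus_embedding_def annulus_retraction_def fst_conv snd_conv
        mult.assoc[symmetric] of_real_mult[symmetric])
  then show ?thesis
    using False by (simp add: sgn_div_norm scaleR_conv_of_real)
qed simp

lemma annulus_retraction_in: "z \<in> cball 0 2 - {0} \<Longrightarrow> annulus_retraction z \<in> closed_annulus"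
  by (auto simp: annulus_retraction_def closed_annulus_def norm_sgn)

lemma continuous_annulus_embedding: "continuous_on S annulus_embedding"
  unfolding annulus_embedding_def by (intro continuous_intros)

lemma continuous_annulus_retraction: "0 \<notin> S \<Longrightarrow> continuous_on S annulus_retraction"
  unfolding annulus_retraction_def by (intro continuous_intros) auto

text \<open>
  By invariance of domain, the interior has open image in the plane, and an open subset of the plane that
  lies in the closed annulus cannot meet the boundary circles.
\<close>
lemma homeomorphism_annulus_interior:
  assumes g: "homeomorphism closed_annulus closed_annulus g g'"
    and x: "x \<in> closed_annulus" "0 < snd x" "snd x < 1"
  shows "0 < snd (g x)" "snd (g x) < 1"
proof -
  define U :: "complex set" where "U = ball 0 2 - cball 0 1"
  define F where "F = annulus_embedding \<circ> g \<circ> annulus_retraction"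
  have U: "annulus_retraction z \<in> closed_annulus" "z \<noteq> 0" "annulus_embedding (annulus_retraction z) = z"
    if "z \<in> U" for z
  proof -
    show "annulus_retraction z \<in> closed_annulus"
      using that by (intro annulus_retraction_in) (auto simp: U_def)
    show "annulus_embedding (annulus_retraction z) = z"
      using annulus_embedding_retraction[of z] that by (simp add: U_def min_def)
  qed (use that in \<open>auto simp: U_def\<close>)
  have gS: "g y \<in> closed_annulus" if "y \<in> closed_annulus" for y
    using homeomorphism_image1[OF g] that by blast
  have contg: "continuous_on closed_annulus g"
    using g homeomorphism_cont1 by blast
  have "continuous_on U F"
    unfolding F_def using U(1,2)
    by (intro continuous_on_compose continuous_annulus_embedding continuous_annulus_retraction
        continuous_on_subset[OF contg]) auto
  moreover have "open U"
    by (simp add: U_def open_Diff)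
  moreover have "inj_on F U"
  proof (rule inj_on_inverseI[where g = "annulus_embedding \<circ> g' \<circ> annulus_retraction"])
    fix z assume z: "z \<in> U"
    then show "(annulus_embedding \<circ> g' \<circ> annulus_retraction) (F z) = z"
      using U(1,3)[OF z] homeomorphism_apply1[OF g U(1)[OF z]]
      by (simp add: F_def annulus_retraction_embedding[OF gS])
  qed
  ultimately have "open (F ` U)"
    by (rule invariance_of_domain)
  have normF: "1 \<le> norm (F z)" "norm (F z) \<le> 2" if "z \<in> U" for z
    using gS[OF U(1)[OF that]] norm_annulus_embedding[OF gS[OF U(1)[OF that]]]
    by (auto simp: F_def closed_annulus_def)
  have "F ` U \<subseteq> interior (cball 0 2)" "F ` U \<subseteq> interior (- ball 0 1)"
    by (rule interior_maximal[OF _ \<open>open (F ` U)\<close>], use normF in force)+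
  then have FU: "F ` U \<subseteq> ball 0 2 - cball 0 1"
    by (auto simp: interior_complement)
  have "annulus_embedding x \<in> U"
    using x norm_annulus_embedding[OF x(1)] by (simp add: U_def)
  then have "F (annulus_embedding x) \<in> ball 0 2 - cball 0 1"
    using FU by blast
  moreover have "norm (F (annulus_embedding x)) = 1 + snd (g x)"
    by (simp add: F_def annulus_retraction_embedding[OF x(1)] norm_annulus_embedding[OF gS[OF x(1)]])
  ultimately show "0 < snd (g x)" "snd (g x) < 1"
    by auto
qed

lemma homeomorphism_annulus_boundary:
  assumes g: "homeomorphism closed_annulus closed_annulus g g'"
    and x: "x \<in> closed_annulus" "snd x = 0 \<or> snd x = 1"
  shows "snd (g x) = 0 \<or> snd (g x) = 1"
proof (rule ccontr)
  assume "\<not> ?thesis"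
  moreover have gx: "g x \<in> closed_annulus"
    using homeomorphism_image1[OF g] x by blast
  ultimately have "0 < snd (g x)" "snd (g x) < 1"
    by (auto simp: closed_annulus_def)
  then have "0 < snd (g' (g x))" "snd (g' (g x)) < 1"
    using homeomorphism_annulus_interior[OF homeomorphism_symD[OF g] gx] by auto
  then show False
    using x homeomorphism_apply1[OF g x(1)] by auto
qed

lemma homeomorphism_annulus_level_constant:
  assumes g: "homeomorphism closed_annulus closed_annulus g g'"
    and j: "j = 0 \<or> j = 1" and z: "z \<in> sphere 0 1" "w \<in> sphere 0 1"
  shows "snd (g (z, j)) = snd (g (w, j))"
proof -
  have in_annulus: "(z, j) \<in> closed_annulus" if "z \<in> sphere 0 1" for z
    using that j by (auto simp: closed_annulus_def)
  have "continuous_on (sphere 0 1) (\<lambda>z. snd (g (z, j)))"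
    using in_annulus
    by (intro continuous_on_snd continuous_on_compose2[OF homeomorphism_cont1[OF g]] continuous_intros) auto
  moreover have "finite ((\<lambda>z. snd (g (z, j))) ` sphere 0 1)"
  proof (rule finite_subset)
    show "(\<lambda>z. snd (g (z, j))) ` sphere 0 1 \<subseteq> {0, 1}"
    proof (rule image_subsetI)
      fix w :: complex assume "w \<in> sphere 0 1"
      then show "snd (g (w, j)) \<in> {0, 1}"
        using homeomorphism_annulus_boundary[OF g in_annulus[of w]] j by simp
    qed
  qed simp
  moreover have "connected (sphere (0::complex) 1)"
    by (intro connected_sphere) simp
  ultimately have "(\<lambda>z. snd (g (z, j))) constant_on sphere 0 1"
    by (intro continuous_finite_range_constant)
  then show ?thesis
    using z unfolding constant_on_def by auto
qed

text \<open>
  The map is extended over the inner disc as the cone of its restriction to the inner circle. This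
  needs the inner circle to be mapped to itself, which holds because the outer circle is already taken. The extension
  has the same period and fixes the boundary of the disc of radius 2.
\<close>
lemma periodic_annulus_homeomorphism_fixing_circle:
  assumes g: "homeomorphism closed_annulus closed_annulus g g'"
    and n: "n > 0" "\<And>x. x \<in> closed_annulus \<Longrightarrow> (g ^^ n) x = x"
    and fixed: "\<And>z. z \<in> sphere 0 1 \<Longrightarrow> g (z, 1) = (z, 1)"
    and x: "x \<in> closed_annulus"
  shows "g x = x"
proof -
  \<comment> \<open>One formula covers the annulus, where the first factor is 1, the cone, where the level is 0, and
    the value 0 at the tip.\<close>
  define f where "f = (\<lambda>z. of_real (min (norm z) 1) * annulus_embedding (g (annulus_retraction z)))"
  have gS: "g y \<in> closed_annulus" if "y \<in> closed_annulus" for y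
    using homeomorphism_image1[OF g] that by blast
  have inner: "snd (g (z, 0)) = 0" if z: "z \<in> sphere 0 1" for z
  proof (rule ccontr)
    have z0: "(z, 0) \<in> closed_annulus"
      using z by (simp add: closed_annulus_def)
    assume "snd (g (z, 0)) \<noteq> 0"
    then have "snd (g (z, 0)) = 1"
      using homeomorphism_annulus_boundary[OF g z0] by auto
    then obtain w where w: "g (z, 0) = (w, 1)"
      by (metis prod.collapse)
    then have "w \<in> sphere 0 1"
      using gS[OF z0] by (auto simp: closed_annulus_def)
    then have "g (w, 1) = g (z, 0)" "(w, 1) \<in> closed_annulus"
      using fixed w by (auto simp: closed_annulus_def)
    then show False
      using homeomorphism_apply1[OF g] z0 by (metis prod.inject zero_neq_one)
  qed
  have step: "f z \<in> cball 0 2 - {0} \<and> annulus_retraction (f z) = g (annulus_retraction z) \<and>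
      min (norm (f z)) 1 = min (norm z) 1" if z: "z \<in> cball 0 2 - {0}" for z
  proof -
    note az = annulus_retraction_in[OF z]
    show ?thesis
    proof (cases "norm z < 1")
      case True
      then have "annulus_retraction z = (sgn z, 0)"
        by (simp add: annulus_retraction_def)
      moreover have "sgn z \<in> sphere 0 1"
        using z by (simp add: norm_sgn)
      ultimately obtain w where w: "g (annulus_retraction z) = (w, 0)"
        using inner by (metis prod.collapse)
      then have nw: "norm w = 1"
        using gS[OF az] by (simp add: closed_annulus_def)
      have fz: "f z = of_real (norm z) * w"
        using True by (simp add: f_def w annulus_embedding_def min_def)
      have nf: "norm (f z) = norm z"
        by (simp add: fz norm_mult nw)
      have "sgn (f z) = w"
        using z nf by (simp add: sgn_div_norm) (simp add: fz scaleR_conv_of_real)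
      then show ?thesis
        using z True nf by (auto simp: annulus_retraction_def[of "f z"] w)
    next
      case False
      then have fz: "f z = annulus_embedding (g (annulus_retraction z))"
        by (simp add: f_def)
      have nf: "norm (f z) = 1 + snd (g (annulus_retraction z))"
        by (simp add: fz norm_annulus_embedding[OF gS[OF az]])
      have "0 \<le> snd (g (annulus_retraction z))" "snd (g (annulus_retraction z)) \<le> 1"
        using gS[OF az] by (auto simp: closed_annulus_def)
      then show ?thesis
        using nf False annulus_retraction_embedding[OF gS[OF az]] by (auto simp: fz)
    qed
  qed
  have f0: "f 0 = 0"
    by (simp add: f_def)
  have iterate: "(f ^^ k) z \<in> cball 0 2 - {0} \<and> annulus_retraction ((f ^^ k) z) = (g ^^ k) (annulus_retraction z) \<and>
      min (norm ((f ^^ k) z)) 1 = min (norm z) 1" if z: "z \<in> cball 0 2 - {0}" for z k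
  proof (induction k)
    case (Suc k)
    then show ?case
      using step[of "(f ^^ k) z"] by simp
  qed (use z in simp)
  interpret periodic_disc_map f 2 n
  proof
    show "n > 0"
      by fact
    show "f ` cball 0 2 \<subseteq> cball 0 2"
    proof (rule image_subsetI)
      show "f z \<in> cball 0 2" if "z \<in> cball 0 2" for z
        using step[of z] that f0 by (cases "z = 0") auto
    qed
    show "(f ^^ n) z = z" if z: "z \<in> cball 0 2" for z
    proof (cases "z = 0")
      case True
      have "(f ^^ n) 0 = 0"
        by (induction n) (simp_all add: f0)
      then show ?thesis
        using True by simp
    next
      case False
      then have zX: "z \<in> cball 0 2 - {0}"
        using z by simp
      have "(f ^^ n) z = of_real (min (norm ((f ^^ n) z)) 1) * annulus_embedding (annulus_retraction ((f ^^ n) z))"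
        by (rule annulus_embedding_retraction[symmetric])
      also have "\<dots> = of_real (min (norm z) 1) * annulus_embedding (annulus_retraction z)"
        using iterate[OF zX, of n] n(2)[OF annulus_retraction_in[OF zX]] by simp
      also have "\<dots> = z"
        by (rule annulus_embedding_retraction)
      finally show ?thesis .
    qed
    show "f z = z" if z: "z \<in> sphere 0 2" for z
    proof -
      have "annulus_retraction z = (sgn z, 1)" "sgn z \<in> sphere 0 1"
        using z by (auto simp: annulus_retraction_def norm_sgn)
      then have "g (annulus_retraction z) = annulus_retraction z"
        using fixed by simp
      then show ?thesis
        using annulus_embedding_retraction[of z] by (simp add: f_def)
    qed
    show "continuous_on (cball 0 2) f"
      unfolding continuous_on_eq_continuous_within
    proof
      fix z :: complex assume z: "z \<in> cball 0 2"
      show "continuous (at z within cball 0 2) f"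
      proof (cases "z = 0")
        case False
        have "continuous_on (cball 0 2 - {0}) (\<lambda>z. annulus_embedding (g (annulus_retraction z)))"
        proof (rule continuous_on_compose2[OF continuous_annulus_embedding[of UNIV]])
          show "continuous_on (cball 0 2 - {0}) (\<lambda>z. g (annulus_retraction z))"
            using annulus_retraction_in
            by (intro continuous_on_compose2[OF homeomorphism_cont1[OF g] continuous_annulus_retraction]) blast+
        qed simp
        then have "continuous_on (cball 0 2 - {0}) f"
          unfolding f_def by (intro continuous_intros)
        then have "continuous (at z within cball 0 2 - {0}) f"
          using z False by (auto simp: continuous_on_eq_continuous_within)
        moreover have "at z within cball 0 2 - {0} = at z within cball 0 2"
          using False by (intro at_within_nhd[of _ "- {0}"]) auto
        ultimately show ?thesis
          by simp
      next
        case True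
        have bound: "norm (f w) \<le> 2 * norm w" if "w \<in> cball 0 2" for w
        proof (cases "w = 0")
          case False
          then have w: "w \<in> cball 0 2 - {0}"
            using that by simp
          have "norm (annulus_embedding (g (annulus_retraction w))) \<le> 2"
            using norm_annulus_embedding[OF gS[OF annulus_retraction_in[OF w]]] gS[OF annulus_retraction_in[OF w]]
            by (auto simp: closed_annulus_def)
          then have "min (norm w) 1 * norm (annulus_embedding (g (annulus_retraction w))) \<le> norm w * 2"
            by (intro mult_mono) auto
          then show ?thesis
            by (simp add: f_def norm_mult)
        qed (simp add: f0)
        have "(f \<longlongrightarrow> 0) (at 0 within cball 0 2)"
        proof (rule Lim_null_comparison)
          show "\<forall>\<^sub>F w in at 0 within cball 0 2. norm (f w) \<le> 2 * norm w"
            using bound by (auto simp: eventually_at_filter)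
          have "((\<lambda>w::complex. 2 * norm w) \<longlongrightarrow> 2 * norm (0::complex)) (at 0 within cball 0 2)"
            by (intro tendsto_intros)
          then show "((\<lambda>w::complex. 2 * norm w) \<longlongrightarrow> 0) (at 0 within cball 0 2)"
            by simp
        qed
        then show ?thesis
          by (simp add: True continuous_within f0)
      qed
    qed
  qed
  have nx: "norm (annulus_embedding x) = 1 + snd x" "0 \<le> snd x" "snd x \<le> 1"
    using norm_annulus_embedding[OF x] x by (auto simp: closed_annulus_def)
  then have "f (annulus_embedding x) = annulus_embedding x"
    by (intro fixes_all) simp
  then have "annulus_embedding (g x) = annulus_embedding x"
    using nx by (simp add: f_def annulus_retraction_embedding[OF x] min_def split: if_splits)
  then show ?thesis
    using annulus_retraction_embedding[OF x] annulus_retraction_embedding[OF gS[OF x]] by simp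
qed

section \<open>Periodic groups of annulus homeomorphisms\<close>

locale periodic_annulus_group =
  fixes \<Gamma> :: "(complex \<times> real \<Rightarrow> complex \<times> real) set"
  assumes subgroup: "subgroup \<Gamma> (HomeoGroup closed_annulus)"
    and periodic: "periodic_group (HomeoGroup closed_annulus \<lparr>carrier := \<Gamma>\<rparr>)"
begin

definition G where "G = HomeoGroup closed_annulus \<lparr>carrier := \<Gamma>\<rparr>"

lemma carrier_G [simp]: "carrier G = \<Gamma>"
  by (simp add: G_def)

sublocale group G
  using periodic by (simp add: periodic_group_def G_def)

lemma in_Homeo: "g \<in> \<Gamma> \<Longrightarrow> g \<in> Homeo closed_annulus"
  using subgroup.subset[OF subgroup] by (auto simp: HomeoGroup_def)

lemma homeomorphism_of_element:
  assumes "g \<in> \<Gamma>"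
  obtains g' where "homeomorphism closed_annulus closed_annulus g g'"
  using in_Homeo[OF assms] by (auto simp: Homeo_def)

lemma element_maps: "g \<in> \<Gamma> \<Longrightarrow> x \<in> closed_annulus \<Longrightarrow> g x \<in> closed_annulus"
  by (metis homeomorphism_of_element homeomorphism_image1 imageI)

lemma element_inj:
  assumes "g \<in> \<Gamma>" "x \<in> closed_annulus" "y \<in> closed_annulus" "g x = g y"
  shows "x = y"
  using assms by (metis homeomorphism_of_element homeomorphism_apply1)

lemma element_eqI:
  assumes "g \<in> \<Gamma>" "h \<in> \<Gamma>" "\<And>x. x \<in> closed_annulus \<Longrightarrow> g x = h x"
  shows "g = h"
  using in_Homeo[OF assms(1)] in_Homeo[OF assms(2)] assms(3)
  by (auto simp: Homeo_def intro: extensionalityI)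

lemma mult_apply:
  assumes "g \<in> \<Gamma>" "h \<in> \<Gamma>" "x \<in> closed_annulus"
  shows "(g \<otimes>\<^bsub>G\<^esub> h) x = g (h x)"
  using in_Homeo[OF assms(1)] in_Homeo[OF assms(2)] Homeo_subset_Bij[of closed_annulus] assms(3)
  by (auto simp: G_def HomeoGroup_def BijGroup_def compose_def)

lemma one_apply: "x \<in> closed_annulus \<Longrightarrow> \<one>\<^bsub>G\<^esub> x = x"
  by (simp add: G_def HomeoGroup_def BijGroup_def)

lemma pow_apply:
  assumes "g \<in> \<Gamma>" "x \<in> closed_annulus"
  shows "(g [^]\<^bsub>G\<^esub> (n::nat)) x = (g ^^ n) x"
  using assms(2)
proof (induction n arbitrary: x)
  case 0
  then show ?case
    by (simp add: one_apply)
next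
  case (Suc n)
  have "(g [^]\<^bsub>G\<^esub> Suc n) x = (g [^]\<^bsub>G\<^esub> n) (g x)"
    using assms(1) Suc.prems mult_apply[of "g [^]\<^bsub>G\<^esub> n" g x] nat_pow_closed[of g n] by simp
  also have "\<dots> = (g ^^ n) (g x)"
    using Suc.IH element_maps[OF assms(1) Suc.prems] by simp
  finally show ?case
    by (simp add: funpow_swap1)
qed

lemma element_period:
  assumes "g \<in> \<Gamma>"
  obtains n where "n > 0" "\<And>x. x \<in> closed_annulus \<Longrightarrow> (g ^^ n) x = x"
proof -
  obtain n :: nat where "n > 0" "g [^]\<^bsub>G\<^esub> n = \<one>\<^bsub>G\<^esub>"
    using periodic assms by (auto simp: periodic_group_def simp flip: G_def)
  then show ?thesis
    using that pow_apply[OF assms] one_apply by metis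
qed

lemma inv_apply:
  assumes "g \<in> \<Gamma>" "x \<in> closed_annulus"
  shows "(inv\<^bsub>G\<^esub> g) (g x) = x" "g ((inv\<^bsub>G\<^esub> g) x) = x"
proof -
  have i: "inv\<^bsub>G\<^esub> g \<in> \<Gamma>"
    using inv_closed assms(1) by simp
  have "inv\<^bsub>G\<^esub> g \<otimes>\<^bsub>G\<^esub> g = \<one>\<^bsub>G\<^esub>" "g \<otimes>\<^bsub>G\<^esub> inv\<^bsub>G\<^esub> g = \<one>\<^bsub>G\<^esub>"
    using l_inv r_inv assms(1) by simp_all
  then show "(inv\<^bsub>G\<^esub> g) (g x) = x" "g ((inv\<^bsub>G\<^esub> g) x) = x"
    using mult_apply[OF i assms(1,2)] mult_apply[OF assms(1) i assms(2)] one_apply[OF assms(2)] by simp_all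
qed

definition outer_map :: "(complex \<times> real \<Rightarrow> complex \<times> real) \<Rightarrow> complex \<Rightarrow> complex"
  where "outer_map g z = fst (g (z, 1))"

text \<open>
  The first component tells to which boundary circle \<open>g\<close> maps the outer one, as the level is constant on its image; the
  second tells whether \<open>g\<close> preserves the orientation when both circles are identified with the unit circle.
\<close>
definition outer_type :: "(complex \<times> real \<Rightarrow> complex \<times> real) \<Rightarrow> real \<times> bool"
  where "outer_type g = (snd (g (1, 1)), \<exists>\<phi>. circle_lift \<phi> (outer_map g) \<and> strict_mono \<phi>)"

definition outer_positive :: "(complex \<times> real \<Rightarrow> complex \<times> real) set"
  where "outer_positive = {g \<in> \<Gamma>. outer_type g = (1, True)}"

lemma outer_in_annulus: "z \<in> sphere 0 1 \<Longrightarrow> (z, 1) \<in> closed_annulus"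
  by (simp add: closed_annulus_def)

lemma level_constant:
  assumes "g \<in> \<Gamma>" "j = 0 \<or> j = 1" "z \<in> sphere 0 1" "w \<in> sphere 0 1"
  shows "snd (g (z, j)) = snd (g (w, j))"
  using homeomorphism_of_element[OF assms(1)] homeomorphism_annulus_level_constant[OF _ assms(2-4)] by metis

lemma outer_eq:
  assumes "g \<in> \<Gamma>" "z \<in> sphere 0 1"
  shows "g (z, 1) = (outer_map g z, snd (g (1, 1)))"
  using level_constant[OF assms(1) _ assms(2), of 1 1] by (simp add: outer_map_def prod_eq_iff)

lemma outer_map_in: "g \<in> \<Gamma> \<Longrightarrow> z \<in> sphere 0 1 \<Longrightarrow> outer_map g z \<in> sphere 0 1"
  using element_maps[OF _ outer_in_annulus, of g z] by (auto simp: outer_map_def closed_annulus_def mem_Times_iff)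

lemma outer_level:
  assumes "g \<in> \<Gamma>"
  shows "snd (g (1, 1)) = 0 \<or> snd (g (1, 1)) = 1"
  using homeomorphism_of_element[OF assms] homeomorphism_annulus_boundary[OF _ outer_in_annulus[of 1]]
  by (metis mem_sphere_0 norm_one snd_conv)

lemma outer_map_lift:
  assumes "g \<in> \<Gamma>"
  obtains \<phi> where "circle_lift \<phi> (outer_map g)" "strict_mono \<phi> \<or> strict_antimono_on UNIV \<phi>"
proof -
  obtain g' where g': "homeomorphism closed_annulus closed_annulus g g'"
    using homeomorphism_of_element[OF assms] .
  have "continuous_on (sphere 0 1) (outer_map g)"
    unfolding outer_map_def using outer_in_annulus
    by (intro continuous_on_fst continuous_on_compose2[OF homeomorphism_cont1[OF g']] continuous_intros) blast
  moreover have "outer_map g ` sphere 0 1 \<subseteq> sphere 0 1"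
    using outer_map_in[OF assms] by blast
  ultimately obtain \<phi> where \<phi>: "circle_lift \<phi> (outer_map g)"
    using circle_lift_exists by blast
  have "inj_on (outer_map g) (sphere 0 1)"
  proof (rule inj_onI)
    fix z w assume zw: "z \<in> sphere 0 1" "w \<in> sphere 0 1" "outer_map g z = outer_map g w"
    then have "g (z, 1) = g (w, 1)"
      by (simp only: outer_eq[OF assms zw(1)] outer_eq[OF assms zw(2)])
    then show "z = w"
      using element_inj[OF assms outer_in_annulus outer_in_annulus] zw by blast
  qed
  then show ?thesis
    using that \<phi> circle_lift_monotone by blast
qed

lemma outer_positiveD:
  assumes "g \<in> outer_positive"
  shows "g \<in> \<Gamma>" "\<And>z. z \<in> sphere 0 1 \<Longrightarrow> g (z, 1) = (outer_map g z, 1)"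
    "\<exists>\<phi>. circle_lift \<phi> (outer_map g) \<and> strict_mono \<phi>"
proof -
  show "g \<in> \<Gamma>" "\<exists>\<phi>. circle_lift \<phi> (outer_map g) \<and> strict_mono \<phi>"
    using assms by (auto simp: outer_positive_def outer_type_def)
  show "g (z, 1) = (outer_map g z, 1)" if "z \<in> sphere 0 1" for z
    using outer_eq[OF \<open>g \<in> \<Gamma>\<close> that] assms by (simp add: outer_positive_def outer_type_def)
qed

lemma outer_map_funpow:
  assumes "g \<in> outer_positive" "z \<in> sphere 0 1"
  shows "(outer_map g ^^ k) z \<in> sphere 0 1 \<and> (g ^^ k) (z, 1) = ((outer_map g ^^ k) z, 1)"
proof (induction k)
  case (Suc k)
  then show ?case
    using outer_positiveD(2)[OF assms(1)] outer_map_in[OF outer_positiveD(1)[OF assms(1)]] by simp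
qed (use assms in simp)

lemma outer_map_period:
  assumes "g \<in> outer_positive"
  obtains n where "n > 0" "\<And>z. z \<in> sphere 0 1 \<Longrightarrow> (outer_map g ^^ n) z = z"
proof -
  obtain n where n: "n > 0" "\<And>x. x \<in> closed_annulus \<Longrightarrow> (g ^^ n) x = x"
    using element_period[OF outer_positiveD(1)[OF assms]] by blast
  have "(outer_map g ^^ n) z = z" if "z \<in> sphere 0 1" for z
    using outer_map_funpow[OF assms that, of n] n(2)[OF outer_in_annulus[OF that]] by simp
  then show ?thesis
    using that n(1) by blast
qed

text \<open>
  If \<open>k = g\<^sup>-\<^sup>1 h\<close>, then \<open>g k = h\<close>, so the composition of lifts of \<open>g\<close> and \<open>k\<close> is a lift of \<open>h\<close>.
  As the lifts of \<open>g\<close> and \<open>h\<close> are monotone in the same direction, that of \<open>k\<close> increases.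
\<close>
lemma same_type_imp_quotient_outer_positive:
  assumes g: "g \<in> \<Gamma>" and h: "h \<in> \<Gamma>" and type: "outer_type g = outer_type h"
  shows "inv\<^bsub>G\<^esub> g \<otimes>\<^bsub>G\<^esub> h \<in> outer_positive"
proof -
  define k where "k = inv\<^bsub>G\<^esub> g \<otimes>\<^bsub>G\<^esub> h"
  define j where "j = snd (g (1, 1))"
  have ig: "inv\<^bsub>G\<^esub> g \<in> \<Gamma>" and k: "k \<in> \<Gamma>"
    using g h inv_closed m_closed unfolding k_def by auto
  have one: "(1::complex) \<in> sphere 0 1"
    by simp
  have jh: "snd (h (1, 1)) = j" and j: "j = 0 \<or> j = 1"
    using type outer_level[OF g] by (auto simp: outer_type_def j_def)
  have g1: "g (1, 1) = (outer_map g 1, j)"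
    using outer_eq[OF g one] unfolding j_def .
  have h1: "h (1, 1) = (outer_map h 1, j)"
    using outer_eq[OF h one] unfolding jh .
  have k_apply: "k x = (inv\<^bsub>G\<^esub> g) (h x)" and gk: "g (k x) = h x" if "x \<in> closed_annulus" for x
    using mult_apply[OF ig h that] inv_apply(2)[OF g element_maps[OF h that]] by (simp_all add: k_def)
  have "snd (k (1, 1)) = snd ((inv\<^bsub>G\<^esub> g) (outer_map h 1, j))"
    using k_apply[OF outer_in_annulus[OF one]] by (simp only: h1)
  also have "\<dots> = snd ((inv\<^bsub>G\<^esub> g) (outer_map g 1, j))"
    by (intro level_constant ig j outer_map_in g h one)
  also have "\<dots> = snd ((inv\<^bsub>G\<^esub> g) (g (1, 1)))"
    by (simp only: g1)
  also have "\<dots> = 1"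
    using inv_apply(1)[OF g outer_in_annulus[OF one]] by simp
  finally have k1: "snd (k (1, 1)) = 1" .
  have comp: "(outer_map g \<circ> outer_map k) z = outer_map h z" if "z \<in> sphere 0 1" for z
  proof -
    have "k (z, 1) = (outer_map k z, 1)"
      using outer_eq[OF k that] unfolding k1 .
    then have "g (outer_map k z, 1) = h (z, 1)"
      using gk[OF outer_in_annulus[OF that]] by simp
    then show ?thesis
      by (simp add: outer_map_def)
  qed
  obtain \<phi> where \<phi>: "circle_lift \<phi> (outer_map g)" "strict_mono \<phi> \<or> strict_antimono_on UNIV \<phi>"
    using outer_map_lift[OF g] .
  obtain \<psi> where \<psi>: "circle_lift \<psi> (outer_map h)" "strict_mono \<psi> \<or> strict_antimono_on UNIV \<psi>"
    using outer_map_lift[OF h] .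
  obtain \<kappa> where \<kappa>: "circle_lift \<kappa> (outer_map k)" "strict_mono \<kappa> \<or> strict_antimono_on UNIV \<kappa>"
    using outer_map_lift[OF k] .
  have lift_mono: "strict_mono \<alpha> \<longleftrightarrow> (\<exists>\<beta>. circle_lift \<beta> u \<and> strict_mono \<beta>)" if \<alpha>: "circle_lift \<alpha> u" for \<alpha> u
  proof
    assume "\<exists>\<beta>. circle_lift \<beta> u \<and> strict_mono \<beta>"
    then obtain \<beta> where \<beta>: "circle_lift \<beta> u" "strict_mono \<beta>"
      by blast
    obtain m :: int where "\<And>x. \<alpha> x = \<beta> x + 2 * pi * m"
      using circle_lift_unique[OF \<alpha> \<beta>(1)] by blast
    then show "strict_mono \<alpha>"
      using \<beta>(2) by (simp add: strict_mono_def)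
  qed (use \<alpha> in blast)
  have same: "strict_mono \<phi> \<longleftrightarrow> strict_mono \<psi>"
    using type lift_mono[OF \<phi>(1)] lift_mono[OF \<psi>(1)] by (simp add: outer_type_def)
  obtain m :: int where m: "\<And>x. \<phi> (\<kappa> x) = \<psi> x + 2 * pi * m"
    using circle_lift_unique[OF circle_lift_compose[OF \<phi>(1) \<kappa>(1)] \<psi>(1) comp] by auto
  have "strict_mono \<kappa>"
  proof (rule ccontr)
    assume "\<not> strict_mono \<kappa>"
    then have \<kappa>10: "\<kappa> 1 < \<kappa> 0"
      using \<kappa>(2) by (auto simp: monotone_on_def)
    show False
    proof (cases "strict_mono \<phi>")
      case True
      then have "\<phi> (\<kappa> 1) < \<phi> (\<kappa> 0)" "\<psi> 0 < \<psi> 1"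
        using \<kappa>10 same by (auto simp: strict_mono_def)
      then show False
        using m[of 0] m[of 1] by simp
    next
      case False
      then have "\<phi> (\<kappa> 0) < \<phi> (\<kappa> 1)" "\<psi> 1 < \<psi> 0"
        using \<phi>(2) \<psi>(2) \<kappa>10 same by (auto simp: monotone_on_def)
      then show False
        using m[of 0] m[of 1] by simp
    qed
  qed
  then have "k \<in> outer_positive"
    using k k1 \<kappa>(1) by (auto simp: outer_positive_def outer_type_def)
  then show ?thesis
    by (simp add: k_def)
qed

lemma outer_positive_mult:
  assumes g: "g \<in> outer_positive" and h: "h \<in> outer_positive"
  shows "g \<otimes>\<^bsub>G\<^esub> h \<in> outer_positive"
    and "z \<in> sphere 0 1 \<Longrightarrow> (g \<otimes>\<^bsub>G\<^esub> h) (z, 1) = (outer_map g (outer_map h z), 1)"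
proof -
  note gD = outer_positiveD[OF g] and hD = outer_positiveD[OF h]
  show mult: "(g \<otimes>\<^bsub>G\<^esub> h) (z, 1) = (outer_map g (outer_map h z), 1)" if z: "z \<in> sphere 0 1" for z
    using mult_apply[OF gD(1) hD(1) outer_in_annulus[OF z]] gD(2)[OF outer_map_in[OF hD(1) z]] hD(2)[OF z] by simp
  obtain \<phi> \<psi> where \<phi>: "circle_lift \<phi> (outer_map g)" "strict_mono \<phi>"
    and \<psi>: "circle_lift \<psi> (outer_map h)" "strict_mono \<psi>"
    using gD(3) hD(3) by blast
  have "circle_lift (\<phi> \<circ> \<psi>) (outer_map (g \<otimes>\<^bsub>G\<^esub> h))"
    using circle_lift_compose[OF \<phi>(1) \<psi>(1)] mult by (simp add: circle_lift_def outer_map_def)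
  moreover have "strict_mono (\<phi> \<circ> \<psi>)"
    using \<phi>(2) \<psi>(2) by (simp add: strict_mono_def)
  moreover have "g \<otimes>\<^bsub>G\<^esub> h \<in> \<Gamma>"
    using gD(1) hD(1) m_closed by simp
  ultimately show "g \<otimes>\<^bsub>G\<^esub> h \<in> outer_positive"
    using mult[of 1] unfolding outer_positive_def outer_type_def by auto
qed

lemma outer_positive_fixing_point_is_one:
  assumes k: "k \<in> outer_positive" and a: "a \<in> sphere 0 1" "outer_map k a = a"
  shows "k = \<one>\<^bsub>G\<^esub>"
proof (rule element_eqI)
  note kD = outer_positiveD[OF k]
  obtain \<kappa> where \<kappa>: "circle_lift \<kappa> (outer_map k)" "strict_mono \<kappa>"
    using kD(3) by blast
  obtain n where n: "n > 0" "\<And>z. z \<in> sphere 0 1 \<Longrightarrow> (outer_map k ^^ n) z = z"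
    using outer_map_period[OF k] by blast
  have "outer_map k z = z" if "z \<in> sphere 0 1" for z
    using periodic_circle_map_with_fixpoint_is_id[OF \<kappa> n a that] .
  then have fixed: "k (z, 1) = (z, 1)" if "z \<in> sphere 0 1" for z
    using kD(2)[OF that] that by simp
  obtain k' where k': "homeomorphism closed_annulus closed_annulus k k'"
    using homeomorphism_of_element[OF kD(1)] .
  obtain l where l: "l > 0" "\<And>x. x \<in> closed_annulus \<Longrightarrow> (k ^^ l) x = x"
    using element_period[OF kD(1)] by blast
  show "k x = \<one>\<^bsub>G\<^esub> x" if "x \<in> closed_annulus" for x
    using periodic_annulus_homeomorphism_fixing_circle[OF k' l fixed that] one_apply[OF that] by simp
  show "k \<in> \<Gamma>"
    by (rule kD(1))
  show "\<one>\<^bsub>G\<^esub> \<in> \<Gamma>"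
    using one_closed by simp
qed

text \<open>
  \<open>g h\<close> and \<open>h g\<close> agree at a point of the outer circle, so their quotient is an outer-positive element with
  a fixed point there.
\<close>
lemma outer_positive_commute:
  assumes g: "g \<in> outer_positive" and h: "h \<in> outer_positive"
  shows "g \<otimes>\<^bsub>G\<^esub> h = h \<otimes>\<^bsub>G\<^esub> g"
proof -
  note gD = outer_positiveD[OF g] and hD = outer_positiveD[OF h]
  obtain \<phi> where \<phi>: "circle_lift \<phi> (outer_map g)" "strict_mono \<phi>"
    using gD(3) by blast
  obtain \<psi> where \<psi>: "circle_lift \<psi> (outer_map h)" "strict_mono \<psi>"
    using hD(3) by blast
  obtain n where n: "n > 0" "\<And>z. z \<in> sphere 0 1 \<Longrightarrow> (outer_map g ^^ n) z = z"
    using outer_map_period[OF g] by blast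
  obtain l where l: "l > 0" "\<And>z. z \<in> sphere 0 1 \<Longrightarrow> (outer_map h ^^ l) z = z"
    using outer_map_period[OF h] by blast
  obtain z where z: "z \<in> sphere 0 1" "outer_map g (outer_map h z) = outer_map h (outer_map g z)"
    using circle_maps_commute_somewhere[OF \<phi> n \<psi> l] by blast
  define a b where "a = g \<otimes>\<^bsub>G\<^esub> h" and "b = h \<otimes>\<^bsub>G\<^esub> g"
  have ab: "a \<in> outer_positive" "b \<in> outer_positive" "a (z, 1) = b (z, 1)"
    unfolding a_def b_def using outer_positive_mult[OF g h] outer_positive_mult[OF h g] z by auto
  note aD = outer_positiveD[OF ab(1)] and bD = outer_positiveD[OF ab(2)]
  have "outer_type a = outer_type b"
    using ab by (simp add: outer_positive_def)
  then have k: "inv\<^bsub>G\<^esub> a \<otimes>\<^bsub>G\<^esub> b \<in> outer_positive"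
    by (rule same_type_imp_quotient_outer_positive[OF aD(1) bD(1)])
  have ia: "inv\<^bsub>G\<^esub> a \<in> \<Gamma>"
    using aD(1) inv_closed by simp
  have "(inv\<^bsub>G\<^esub> a \<otimes>\<^bsub>G\<^esub> b) (z, 1) = (z, 1)"
    using mult_apply[OF ia bD(1) outer_in_annulus[OF z(1)]] inv_apply(1)[OF aD(1) outer_in_annulus[OF z(1)]] ab(3)
    by simp
  then have "inv\<^bsub>G\<^esub> a \<otimes>\<^bsub>G\<^esub> b = \<one>\<^bsub>G\<^esub>"
    using outer_positive_fixing_point_is_one[OF k z(1)] by (simp add: outer_map_def)
  then have "inv\<^bsub>G\<^esub> b = inv\<^bsub>G\<^esub> a"
    by (rule inv_equality) (simp_all add: bD(1) ia)
  then have "inv\<^bsub>G\<^esub> (inv\<^bsub>G\<^esub> b) = inv\<^bsub>G\<^esub> (inv\<^bsub>G\<^esub> a)"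
    by (rule arg_cong)
  then have "a = b"
    using inv_inv[of a] inv_inv[of b] aD(1) bD(1) by simp
  then show ?thesis
    by (simp add: a_def b_def)
qed

end

theorem corollary1:
  fixes \<Gamma> :: "(complex \<times> real \<Rightarrow> complex \<times> real) set"
  assumes "subgroup \<Gamma> (HomeoGroup closed_annulus)"
    and "finitely_generated_group (HomeoGroup closed_annulus \<lparr>carrier := \<Gamma>\<rparr>)"
    and "periodic_group (HomeoGroup closed_annulus \<lparr>carrier := \<Gamma>\<rparr>)"
  shows "finite \<Gamma>"
proof -
  interpret periodic_annulus_group \<Gamma>
    using assms(1,3) by (rule periodic_annulus_group.intro)
  obtain X where X: "finite X" "X \<subseteq> \<Gamma>" "generate G X = \<Gamma>"
    using assms(2) by (auto simp: finitely_generated_group_def G_def)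
  have "finite (carrier G)"
  proof (rule group.finite_if_virtually_commuting_torsion[where \<tau> = outer_type and H = outer_positive])
    show "group G"
      by (rule is_group)
    show "finite X" "X \<subseteq> carrier G" "generate G X = carrier G"
      using X by simp_all
    show "\<exists>n>0. x [^]\<^bsub>G\<^esub> (n::nat) = \<one>\<^bsub>G\<^esub>" if "x \<in> carrier G" for x
      using assms(3) that by (auto simp: periodic_group_def simp flip: G_def)
    have "outer_type ` \<Gamma> \<subseteq> {0, 1} \<times> UNIV"
      using outer_level by (auto simp: outer_type_def)
    then show "finite (outer_type ` carrier G)"
      unfolding carrier_G by (rule finite_subset) simp
    show "inv\<^bsub>G\<^esub> g \<otimes>\<^bsub>G\<^esub> h \<in> outer_positive"
      if "g \<in> carrier G" "h \<in> carrier G" "outer_type g = outer_type h" for g h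
      using same_type_imp_quotient_outer_positive that by simp
    show "x \<otimes>\<^bsub>G\<^esub> y = y \<otimes>\<^bsub>G\<^esub> x" if "x \<in> outer_positive" "y \<in> outer_positive" for x y
      using outer_positive_commute[OF that] .
  qed
  then show ?thesis
    by simp
qed

end
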